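(* Let $p$ be a prime integer, and let $A$ be a discrete valuation ring with uniformizer $p$ and perfect residue field, and assume that $A$ has a $p$-derivation. Let $S=A[x_1,\ldots,x_m]$ be graded with $\deg(x_i)>0$ for all $i$, and let $f_1,\ldots,f_t\in S$ be homogeneous elements of positive degree, each of degree at most $D$, such that $R=A[f_1,\ldots,f_t]\subseteq S$ is a graded direct summand of $S$. Let $\mathfrak{m}=(f_1,\ldots,f_t,p)R$. Then $Q^{(nD)}\subseteq \mathfrak{m}^n$ for all $n\geq 1$ and all homogeneous prime ideals $Q$ of $R$.
   Context: All rings are commutative with identity. Elements of $A$ have degree $0$ in $S$, and $R=A[f_1,\ldots,f_t]$ is the graded $A$-subalgebra of $S$ generated by $f_1,\ldots,f_t$. $p$-derivation: if $T$ is a ring in which $p$ is a nonzerodivisor, a map of sets $\delta:T\to T$ is a $p$-derivation if the map $\phi_p:T\to T$, $\phi_p(x)=x^p+p\,\delta(x)$, is a ring homomorphism. Graded direct summand: for an inclusion of graded rings $R\subseteq S$, $R$ is a graded direct summand of $S$ if there is a degree-preserving $R$-linear map $\beta:S\to R$ that splits the inclusion (i.e. $\beta|_R=\mathrm{id}_R$). Symbolic powers: for a prime ideal $Q$ of $R$, $Q^{(n)}=Q^nR_Q\cap R$. *)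

theory Defs
  imports
    "HOL-Library.Poly_Mapping"
    "HOL-Computational_Algebra.Primes"
    "HOL-Computational_Algebra.Fraction_Field"
    "HOL-Algebra.Algebra"
    "HOL-Algebra.Algebraic_Closure_Type"
begin

text \<open>A subset of a type-class ring, viewed as a ring in the sense of HOL-Algebra with the
  operations of the type.\<close>

abbreviation ring_on :: "'a::comm_ring_1 set \<Rightarrow> 'a ring"
  where "ring_on U \<equiv> ring_of_type_algebra\<lparr>carrier := U\<rparr>"

abbreviation ideal_power :: "('a, 'b) ring_scheme \<Rightarrow> 'a set \<Rightarrow> nat \<Rightarrow> 'a set"
  where "ideal_power R I n \<equiv> I [^]\<^bsub>ideals_set R\<^esub> n"


subsection \<open>The base ring\<close>

definition discrete_valuation_ring :: "('a, 'b) ring_scheme \<Rightarrow> bool"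
  where "discrete_valuation_ring R \<longleftrightarrow>
    principal_domain R \<and> \<not> field R \<and> (\<exists>!M. maximalideal M R)"

definition uniformizer :: "('a, 'b) ring_scheme \<Rightarrow> 'a \<Rightarrow> bool"
  where "uniformizer R u \<longleftrightarrow> u \<in> carrier R \<and> maximalideal (Idl\<^bsub>R\<^esub> {u}) R"

text \<open>At most one prime \<open>q\<close> vanishes in \<open>k\<close>, namely the characteristic; the condition is empty in
  characteristic zero.\<close>

definition perfect_field :: "('a, 'b) ring_scheme \<Rightarrow> bool"
  where "perfect_field k \<longleftrightarrow> field k \<and>
    (\<forall>q::nat. Factorial_Ring.prime q \<longrightarrow> [q] \<cdot>\<^bsub>k\<^esub> \<one>\<^bsub>k\<^esub> = \<zero>\<^bsub>k\<^esub> \<longrightarrow>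
      (\<lambda>x. x [^]\<^bsub>k\<^esub> q) ` carrier k = carrier k)"

definition p_derivation :: "nat \<Rightarrow> ('a::comm_ring_1 \<Rightarrow> 'a) \<Rightarrow> bool"
  where "p_derivation p \<delta> \<longleftrightarrow>
    (\<forall>x::'a. of_nat p * x = 0 \<longrightarrow> x = 0) \<and>
    (\<lambda>x. x ^ p + of_nat p * \<delta> x) \<in> ring_hom ring_of_type_algebra ring_of_type_algebra"


subsection \<open>Graded polynomial rings\<close>

text \<open>Polynomials in \<open>x\<^sub>1, x\<^sub>2, \<dots>\<close>: an exponent vector is a finitely supported function
  \<open>nat \<Rightarrow>\<^sub>0 nat\<close>, and a polynomial maps finitely many exponent vectors to nonzero coefficients.\<close>

type_synonym 'a mpoly = "(nat \<Rightarrow>\<^sub>0 nat) \<Rightarrow>\<^sub>0 'a"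

abbreviation mconst :: "'a::zero \<Rightarrow> 'a mpoly"
  where "mconst a \<equiv> Poly_Mapping.single 0 a"

definition polynomials :: "nat \<Rightarrow> 'a::zero mpoly set"
  where "polynomials m = {f. \<forall>\<alpha>\<in>Poly_Mapping.keys f. Poly_Mapping.keys \<alpha> \<subseteq> {1..m}}"

definition weighted_degree :: "(nat \<Rightarrow> nat) \<Rightarrow> (nat \<Rightarrow>\<^sub>0 nat) \<Rightarrow> nat"
  where "weighted_degree w \<alpha> = (\<Sum>i\<in>Poly_Mapping.keys \<alpha>. Poly_Mapping.lookup \<alpha> i * w i)"

text \<open>The graded piece of degree \<open>d\<close> when \<open>x\<^sub>i\<close> has degree \<open>w i\<close> and constants have degree zero.
  It contains \<open>0\<close> for every \<open>d\<close>.\<close>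

definition homogeneous_of_degree :: "(nat \<Rightarrow> nat) \<Rightarrow> nat \<Rightarrow> 'a::zero mpoly set"
  where "homogeneous_of_degree w d = {f. \<forall>\<alpha>\<in>Poly_Mapping.keys f. weighted_degree w \<alpha> = d}"

definition subalgebra_generated :: "'a::comm_ring_1 mpoly set \<Rightarrow> 'a mpoly set"
  where "subalgebra_generated F = generate_ring ring_of_type_algebra (range mconst \<union> F)"

text \<open>In the next two definitions \<open>G d\<close> is the degree \<open>d\<close> piece of the ambient ring, and a graded
  subring \<open>R\<close> carries the induced grading \<open>R \<inter> G d\<close>.\<close>

definition graded_direct_summand :: "(nat \<Rightarrow> 'b::comm_ring_1 set) \<Rightarrow> 'b set \<Rightarrow> 'b set \<Rightarrow> bool"
  where "graded_direct_summand G R S \<longleftrightarrow> R \<subseteq> S \<and>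
    (\<exists>\<beta>. \<beta> \<in> S \<rightarrow> R \<and>
      (\<forall>s\<in>S. \<forall>s'\<in>S. \<beta> (s + s') = \<beta> s + \<beta> s') \<and>
      (\<forall>r\<in>R. \<forall>s\<in>S. \<beta> (r * s) = r * \<beta> s) \<and>
      (\<forall>d. \<beta> ` (S \<inter> G d) \<subseteq> R \<inter> G d) \<and>
      (\<forall>r\<in>R. \<beta> r = r))"

definition homogeneous_ideal :: "(nat \<Rightarrow> 'b::comm_ring_1 set) \<Rightarrow> 'b set \<Rightarrow> 'b set \<Rightarrow> bool"
  where "homogeneous_ideal G R I \<longleftrightarrow> (\<exists>H \<subseteq> (\<Union>d. R \<inter> G d). I = Idl\<^bsub>ring_on R\<^esub> H)"


subsection \<open>Symbolic powers\<close>

text \<open>For a subring \<open>R\<close> of an integral domain, every localization of \<open>R\<close> at a prime is a subring of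
  the fraction field of the ambient domain, and \<open>x \<mapsto> Fract x 1\<close> restricts to the (injective)
  localization map.\<close>

definition localization_at :: "'b::idom set \<Rightarrow> 'b set \<Rightarrow> 'b fract set"
  where "localization_at R Q = {Fraction_Field.Fract r s | r s. r \<in> R \<and> s \<in> R - Q}"

definition symbolic_power :: "'b::idom set \<Rightarrow> 'b set \<Rightarrow> nat \<Rightarrow> 'b set"
  where "symbolic_power R Q n =
    {x \<in> R. Fraction_Field.Fract x 1 \<in>
      Idl\<^bsub>ring_on (localization_at R Q)\<^esub>
        ((\<lambda>y. Fraction_Field.Fract y 1) ` ideal_power (ring_on R) Q n)}"

end

theory Submission
  imports Defs
begin

text \<open>Put \<open>W = R - Q\<close>. Every \<open>x\<close> in \<open>Q\<^sup>(\<^sup>k\<^sup>)\<close> satisfies \<open>s x \<in> Q\<^sup>k\<close> for some \<open>s \<in> W\<close>, so it belongs to the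
  set \<open>P\<^sub>k = {y \<in> T. \<exists>s\<in>W. s y \<in> Q\<^sup>k T}\<close> for every ring \<open>T\<close> containing \<open>R\<close>. Here \<open>T\<close> is the
  polynomial ring over \<open>A\<close> in all variables \<open>X\<^sub>i\<close>; it contains \<open>S = A[x\<^sub>1, \<dots>, x\<^sub>m]\<close> and further variables
  \<open>z\<^sub>i = X\<^sub>m\<^sub>+\<^sub>i\<close>. The point of enlarging \<open>R\<close> is that \<open>T\<close> has derivations and \<open>p\<close>-derivations, which need
  not preserve \<open>R\<close>.

  Both kinds of operators lose at most one order: a derivation of \<open>T\<close> maps \<open>P\<^sub>k\<^sub>+\<^sub>1\<close> into \<open>P\<^sub>k\<close>
  (\<open>derivation_saturated_power\<close>), and so does a \<open>p\<close>-derivation if \<open>p \<in> Q\<close> (\<open>delta_saturated_power\<close>).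
  Hence fewer than \<open>k\<close> operators map \<open>P\<^sub>k\<close> into \<open>P\<^sub>1\<close>. The elements of \<open>P\<^sub>1\<close> are controlled by the
  splitting \<open>\<beta> : S \<rightarrow> R\<close>: as \<open>\<beta>\<close> is \<open>R\<close>-linear, \<open>s y \<in> Q S\<close> implies \<open>s \<beta>(y) \<in> Q\<close> and thus \<open>\<beta>(y) \<in> Q\<close>;
  as \<open>\<beta>\<close> preserves constant terms and \<open>Q\<close> is homogeneous, the constant term of \<open>y\<close> lies in \<open>Q \<inter> A\<close>. Applied
  coefficientwise this shows for \<open>y \<in> P\<^sub>1\<close> that all its coefficients at monomials free of \<open>x\<^sub>1, \<dots>, x\<^sub>m\<close>
  lie in \<open>Q \<inter> A\<close> (\<open>coeff_in_prime_of_saturated\<close>).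

  The consequence for \<open>x = \<Sum>\<^sub>\<alpha> c\<^sub>\<alpha> x\<^sup>\<alpha>\<close> in \<open>R \<inter> P\<^sub>k\<close> is that \<open>p\<close> divides \<open>c\<^sub>\<alpha>\<close> at least \<open>k - |\<alpha>|\<close> times. If
  \<open>p \<notin> Q\<close>, then \<open>Q \<inter> A = 0\<close> because \<open>A\<close> is a discrete valuation ring, and iterated partial derivatives
  show that even \<open>c\<^sub>\<alpha> = 0\<close> for \<open>|\<alpha>| < k\<close>, the characteristic being zero (\<open>lookup_eq_0_of_saturated\<close>). If
  \<open>p \<in> Q\<close>, then \<open>Q \<inter> A = pA\<close>, and the claim is that \<open>p\<^sup>k\<close> divides \<open>\<psi>(x)\<close>, where \<open>\<psi>\<close> substitutes \<open>p z\<^sub>i\<close> for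
  \<open>x\<^sub>i\<close>. A lift of Frobenius to \<open>T\<close> can be chosen such that \<open>\<psi>\<close> commutes with the \<open>p\<close>-derivations on source
  and target; on the target the \<open>p\<close>-derivation lowers the order in \<open>p\<close> by at most one, so the claim follows
  by induction from the description of \<open>P\<^sub>1\<close> (\<open>power_dvd_blowup_of_saturated\<close>).

  With \<open>k = n D\<close>, the degree \<open>d\<close> part of \<open>x\<close> is then \<open>p\<close> to the power \<open>n D - d\<close> times an element of \<open>R\<close> of degree
  \<open>d\<close>, and the latter is a combination of products of at least \<open>d/D\<close> of the generators. Together these are
  at least \<open>n\<close> factors from \<open>\<mm>\<close> (\<open>in_ideal_power_of_coeffs\<close>).\<close>

section \<open>Additive extensions and ring homomorphisms of polynomials\<close>

definition lin_ext :: "('k \<Rightarrow> 'a \<Rightarrow> 'b) \<Rightarrow> ('k \<Rightarrow>\<^sub>0 'a::zero) \<Rightarrow> 'b::comm_monoid_add"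
  where "lin_ext E f = (\<Sum>\<alpha>\<in>Poly_Mapping.keys f. E \<alpha> (Poly_Mapping.lookup f \<alpha>))"

lemma lin_ext_zero [simp]: "lin_ext E 0 = 0"
  by (simp add: lin_ext_def)

lemma lin_ext_single:
  assumes "E \<alpha> 0 = 0"
  shows "lin_ext E (Poly_Mapping.single \<alpha> c) = E \<alpha> c"
  using assms by (simp add: lin_ext_def)

lemma lin_ext_add:
  assumes "\<And>\<alpha>. E \<alpha> 0 = 0" and "\<And>\<alpha> a b. E \<alpha> (a + b) = E \<alpha> a + E \<alpha> b"
  shows "lin_ext E (f + g) = lin_ext E f + lin_ext E g"
  unfolding lin_ext_def by (rule setsum_keys_plus_distrib) (use assms in auto)

lemma poly_mapping_eq_sum_singles:
  "f = (\<Sum>\<alpha>\<in>Poly_Mapping.keys f. Poly_Mapping.single \<alpha> (Poly_Mapping.lookup f \<alpha>))"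
  by (rule poly_mapping_eqI)
     (simp add: lookup_sum lookup_single when_def in_keys_iff)

lemma poly_mapping_singles_induct [case_names zero single add]:
  fixes f :: "'k \<Rightarrow>\<^sub>0 'a::comm_monoid_add"
  assumes "P 0"
    and "\<And>\<alpha> c. \<alpha> \<in> Poly_Mapping.keys f \<Longrightarrow> P (Poly_Mapping.single \<alpha> c)"
    and add: "\<And>g h. P g \<Longrightarrow> P h \<Longrightarrow> P (g + h)"
  shows "P f"
proof -
  have "P (\<Sum>\<alpha>\<in>A. Poly_Mapping.single \<alpha> (Poly_Mapping.lookup f \<alpha>))"
    if "finite A" "A \<subseteq> Poly_Mapping.keys f" for A
    using that by (induction A rule: finite_induct) (auto intro: assms)
  from this[of "Poly_Mapping.keys f"] show ?thesis
    using poly_mapping_eq_sum_singles[of f] by simp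
qed

lemma lin_ext_mult:
  fixes E :: "'k::comm_monoid_add \<Rightarrow> 'a::comm_ring_1 \<Rightarrow> 'b::comm_ring_1"
  assumes E0: "\<And>\<alpha>. E \<alpha> 0 = 0" and Ea: "\<And>\<alpha> a b. E \<alpha> (a + b) = E \<alpha> a + E \<alpha> b"
    and Em: "\<And>\<alpha> \<beta> a b. E (\<alpha> + \<beta>) (a * b) = E \<alpha> a * E \<beta> b"
  shows "lin_ext E (f * g) = lin_ext E f * lin_ext E g"
proof (induction f rule: poly_mapping_singles_induct)
  case (single \<alpha> c)
  show ?case
    by (induction g rule: poly_mapping_singles_induct)
       (simp_all add: mult_single lin_ext_single lin_ext_add E0 Ea Em algebra_simps)
qed (simp_all add: lin_ext_add E0 Ea algebra_simps)

definition monom_eval :: "('k \<Rightarrow> 'b::comm_monoid_mult) \<Rightarrow> ('k \<Rightarrow>\<^sub>0 nat) \<Rightarrow> 'b"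
  where "monom_eval g \<alpha> = (\<Prod>i\<in>Poly_Mapping.keys \<alpha>. g i ^ Poly_Mapping.lookup \<alpha> i)"

lemma monom_eval_superset:
  assumes "finite A" "Poly_Mapping.keys \<alpha> \<subseteq> A"
  shows "monom_eval g \<alpha> = (\<Prod>i\<in>A. g i ^ Poly_Mapping.lookup \<alpha> i)"
  unfolding monom_eval_def using assms
  by (intro prod.mono_neutral_left) (auto simp: in_keys_iff)

lemma monom_eval_zero [simp]: "monom_eval g 0 = 1"
  by (simp add: monom_eval_def)

lemma monom_eval_single: "monom_eval g (Poly_Mapping.single i n) = g i ^ n"
  by (simp add: monom_eval_def)

lemma monom_eval_add: "monom_eval g (\<alpha> + \<beta>) = monom_eval g \<alpha> * monom_eval g \<beta>"
proof -
  let ?A = "Poly_Mapping.keys \<alpha> \<union> Poly_Mapping.keys \<beta>"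
  have "monom_eval g (\<alpha> + \<beta>) = (\<Prod>i\<in>?A. g i ^ Poly_Mapping.lookup (\<alpha> + \<beta>) i)"
    by (intro monom_eval_superset) (simp_all add: keys_add)
  also have "\<dots> = monom_eval g \<alpha> * monom_eval g \<beta>"
    by (simp add: monom_eval_superset[of ?A] lookup_add power_add prod.distrib)
  finally show ?thesis .
qed

definition Var :: "nat \<Rightarrow> 'a::comm_ring_1 mpoly"
  where "Var i = Poly_Mapping.single (Poly_Mapping.single i 1) 1"

lemma mconst_add: "mconst (a + b) = mconst a + mconst b"
  by (simp add: single_add)

lemma mconst_mult: "mconst (a * b) = mconst a * mconst b"
  by (simp add: mult_single)

lemma single_one_power:
  "Poly_Mapping.single \<alpha> (1::'a::comm_ring_1) ^ n = Poly_Mapping.single (\<Sum>i<n. \<alpha>) 1"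
  by (induction n) (simp_all add: mult_single add.commute)

lemma single_one_eq_monom_eval:
  "Poly_Mapping.single \<alpha> (1::'a::comm_ring_1) = monom_eval Var \<alpha>"
proof (induction \<alpha> rule: poly_mapping_singles_induct)
  case (single i n)
  have "(\<Sum>j<n. Poly_Mapping.single i (1::nat)) = Poly_Mapping.single i n"
    by (rule poly_mapping_eqI) (simp add: lookup_sum lookup_single when_def del: sum_constant, simp)
  thus ?case by (simp add: monom_eval_single single_one_power Var_def del: sum_constant)
next
  case (add \<alpha> \<beta>)
  thus ?case by (simp add: monom_eval_add mult_single flip: add.IH)
qed simp

lemma monom_eval_closed:
  assumes "P 1" "\<And>a b. P a \<Longrightarrow> P b \<Longrightarrow> P (a * b)" "\<And>i. P (g i)"
  shows "P (monom_eval g \<alpha>)"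
proof -
  have pow: "P (g i ^ n)" for i n by (induction n) (auto intro: assms)
  have "P (\<Prod>i\<in>A. g i ^ Poly_Mapping.lookup \<alpha> i)" if "finite A" for A
    using that by (induction A rule: finite_induct) (auto intro: assms pow)
  thus ?thesis by (simp add: monom_eval_def)
qed

text \<open>Congruences such as \<open>\<phi> f \<equiv> f\<^sup>p\<close> modulo \<open>p\<close> are stable under sums and products but are not
  linear, so they have to be checked on constants and variables instead of on monomials.\<close>

lemma mpoly_ring_induct [case_names const var add mult]:
  fixes f :: "'a::comm_ring_1 mpoly"
  assumes c: "\<And>c. P (mconst c)" and v: "\<And>i. P (Var i)"
    and a: "\<And>g h. P g \<Longrightarrow> P h \<Longrightarrow> P (g + h)" and m: "\<And>g h. P g \<Longrightarrow> P h \<Longrightarrow> P (g * h)"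
  shows "P f"
proof (induction f rule: poly_mapping_singles_induct)
  case zero
  show ?case using c[of 0] by simp
next
  case (single \<alpha> b)
  have "P (monom_eval Var \<alpha>)"
    by (rule monom_eval_closed) (use c[of 1] m v in auto)
  hence "P (mconst b * Poly_Mapping.single \<alpha> 1)"
    by (intro m c) (simp add: single_one_eq_monom_eval)
  thus ?case by (simp add: mult_single)
qed (auto intro: a)

definition mpoly_eval :: "('a \<Rightarrow> 'b) \<Rightarrow> (nat \<Rightarrow> 'b) \<Rightarrow> 'a::zero mpoly \<Rightarrow> 'b::comm_ring_1"
  where "mpoly_eval h g = lin_ext (\<lambda>\<alpha> c. h c * monom_eval g \<alpha>)"

definition is_ring_hom :: "('a::comm_ring_1 \<Rightarrow> 'b::comm_ring_1) \<Rightarrow> bool"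
  where "is_ring_hom h \<longleftrightarrow> h 1 = 1 \<and> (\<forall>x y. h (x + y) = h x + h y) \<and> (\<forall>x y. h (x * y) = h x * h y)"

lemma is_ring_homD:
  assumes "is_ring_hom h"
  shows "h 1 = 1" "h (x + y) = h x + h y" "h (x * y) = h x * h y" "h 0 = 0"
    "h (- x) = - h x" "h (x - y) = h x - h y" "h (x ^ n) = h x ^ n" "h (of_nat n) = of_nat n"
proof -
  show 1: "h 1 = 1" and a: "h (x + y) = h x + h y" and m: "h (x * y) = h x * h y" for x y
    using assms by (auto simp: is_ring_hom_def)
  show 0: "h 0 = 0" using a[of 0 0] by simp
  show n: "h (- x) = - h x" for x using a[of x "-x"] 0 by (simp add: eq_neg_iff_add_eq_0 add.commute)
  show "h (x - y) = h x - h y" using a[of x "-y"] n by simp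
  show "h (x ^ n) = h x ^ n" by (induction n) (simp_all add: 1 m)
  show "h (of_nat n) = of_nat n" by (induction n) (simp_all add: 0 1 a)
qed

lemma is_ring_hom_comp:
  assumes "is_ring_hom h" "is_ring_hom k"
  shows "is_ring_hom (\<lambda>x. h (k x))"
  using assms by (simp add: is_ring_hom_def)

lemma is_ring_hom_mconst: "is_ring_hom mconst"
  by (simp add: is_ring_hom_def mconst_add mconst_mult)

lemma mpoly_eval_single:
  assumes "is_ring_hom h"
  shows "mpoly_eval h g (Poly_Mapping.single \<alpha> c) = h c * monom_eval g \<alpha>"
  using assms by (simp add: mpoly_eval_def lin_ext_single is_ring_homD)

lemma mpoly_eval_ring_hom:
  assumes "is_ring_hom h"
  shows "is_ring_hom (mpoly_eval h g)"
proof -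
  note H = is_ring_homD[OF assms]
  have "mpoly_eval h g 1 = 1"
    using mpoly_eval_single[OF assms, of g 0 1] by (simp add: H)
  moreover have "mpoly_eval h g (x + y) = mpoly_eval h g x + mpoly_eval h g y" for x y
    unfolding mpoly_eval_def by (rule lin_ext_add) (simp_all add: H algebra_simps)
  moreover have "mpoly_eval h g (x * y) = mpoly_eval h g x * mpoly_eval h g y" for x y
    unfolding mpoly_eval_def by (rule lin_ext_mult) (simp_all add: H monom_eval_add algebra_simps)
  ultimately show ?thesis by (simp add: is_ring_hom_def)
qed

lemma mpoly_eval_mconst:
  assumes "is_ring_hom h"
  shows "mpoly_eval h g (mconst c) = h c"
  by (simp add: mpoly_eval_single[OF assms])

lemma mpoly_eval_Var:
  assumes "is_ring_hom h"
  shows "mpoly_eval h g (Var i) = g i"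
  by (simp add: Var_def mpoly_eval_single[OF assms] monom_eval_single is_ring_homD[OF assms])

lemma ring_hom_mpoly_eqI:
  fixes h k :: "'a::comm_ring_1 mpoly \<Rightarrow> 'b::comm_ring_1"
  assumes "is_ring_hom h" "is_ring_hom k"
    and "\<And>c. h (mconst c) = k (mconst c)" "\<And>i. h (Var i) = k (Var i)"
  shows "h f = k f"
  by (induction f rule: mpoly_ring_induct) (simp_all add: assms is_ring_homD)

section \<open>Subrings, powers of ideals and symbolic powers\<close>

lemma ring_of_type_algebra_simps [simp]:
  "carrier (ring_of_type_algebra :: 'a::comm_ring_1 ring) = UNIV"
  "monoid.mult (ring_of_type_algebra :: 'a::comm_ring_1 ring) = (*)"
  "one (ring_of_type_algebra :: 'a::comm_ring_1 ring) = 1"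
  "ring.zero (ring_of_type_algebra :: 'a::comm_ring_1 ring) = 0"
  "add (ring_of_type_algebra :: 'a::comm_ring_1 ring) = (+)"
  by (simp_all add: ring_of_type_algebra_def fun_eq_iff)

lemma ring_of_type_algebra_a_inv [simp]:
  "a_inv (ring_of_type_algebra :: 'a::comm_ring_1 ring) x = - x"
proof -
  interpret ring "ring_of_type_algebra :: 'a ring" by (rule ring_from_type_algebra)
  show ?thesis by (rule minus_equality) simp_all
qed

definition subring_set :: "'a::comm_ring_1 set \<Rightarrow> bool"
  where "subring_set U \<longleftrightarrow> 1 \<in> U \<and> (\<forall>x\<in>U. - x \<in> U) \<and> (\<forall>x\<in>U. \<forall>y\<in>U. x + y \<in> U \<and> x * y \<in> U)"

lemma subring_setD:
  assumes "subring_set U"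
  shows "1 \<in> U" "0 \<in> U" "x \<in> U \<Longrightarrow> - x \<in> U" "x \<in> U \<Longrightarrow> y \<in> U \<Longrightarrow> x + y \<in> U"
    "x \<in> U \<Longrightarrow> y \<in> U \<Longrightarrow> x * y \<in> U" "x \<in> U \<Longrightarrow> x ^ n \<in> U"
proof -
  show 1: "1 \<in> U" and n: "x \<in> U \<Longrightarrow> - x \<in> U" and a: "x \<in> U \<Longrightarrow> y \<in> U \<Longrightarrow> x + y \<in> U"
    and m: "x \<in> U \<Longrightarrow> y \<in> U \<Longrightarrow> x * y \<in> U" for x y
    using assms by (auto simp: subring_set_def)
  show "0 \<in> U" using a[OF 1 n[OF 1]] by simp
  show "x \<in> U \<Longrightarrow> x ^ n \<in> U" by (induction n) (auto intro: 1 m)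
qed

lemma cring_ring_on:
  assumes "subring_set U"
  shows "cring (ring_on U)"
proof -
  note U = subring_setD[OF assms]
  have "\<exists>y\<in>U. x + y = 0" if "x \<in> U" for x
    using that U by (intro bexI[of _ "-x"]) auto
  moreover have "\<exists>y\<in>U. y + x = 0" if "x \<in> U" for x
    using that U by (intro bexI[of _ "-x"]) auto
  ultimately show ?thesis
    by unfold_locales (auto simp: U Units_def algebra_simps)
qed

lemma subring_set_generate_ring: "subring_set (generate_ring ring_of_type_algebra H)"
  unfolding subring_set_def
proof (intro conjI ballI)
  let ?G = "generate_ring ring_of_type_algebra H"
  show "1 \<in> ?G" using generate_ring.one[of ring_of_type_algebra H] by simp
  show "- x \<in> ?G" if "x \<in> ?G" for x using generate_ring.a_inv[OF that] by simp
  show "x + y \<in> ?G" "x * y \<in> ?G" if "x \<in> ?G" "y \<in> ?G" for x y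
    using generate_ring.eng_add[OF that] generate_ring.eng_mult[OF that] by simp_all
qed

lemma ring_on_idealD:
  assumes "ideal I (ring_on U)"
  shows "I \<subseteq> U" "0 \<in> I" "x \<in> I \<Longrightarrow> y \<in> I \<Longrightarrow> x + y \<in> I"
    "x \<in> I \<Longrightarrow> u \<in> U \<Longrightarrow> u * x \<in> I" "x \<in> I \<Longrightarrow> u \<in> U \<Longrightarrow> x * u \<in> I"
proof -
  interpret ideal I "ring_on U" by fact
  show "I \<subseteq> U" "0 \<in> I"
    using a_subset additive_subgroup.zero_closed[OF ideal.axioms(1)[OF assms]] by auto
  show "x \<in> I \<Longrightarrow> y \<in> I \<Longrightarrow> x + y \<in> I"
    using additive_subgroup.a_closed[OF ideal.axioms(1)[OF assms], of x y] by simp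
  show "x \<in> I \<Longrightarrow> u \<in> U \<Longrightarrow> u * x \<in> I" "x \<in> I \<Longrightarrow> u \<in> U \<Longrightarrow> x * u \<in> I"
    using I_l_closed I_r_closed by auto
qed

lemma ring_on_idealI:
  assumes U: "subring_set U" and "I \<subseteq> U" "0 \<in> I" "\<And>x y. x \<in> I \<Longrightarrow> y \<in> I \<Longrightarrow> x + y \<in> I"
    and m: "\<And>x u. x \<in> I \<Longrightarrow> u \<in> U \<Longrightarrow> u * x \<in> I"
  shows "ideal I (ring_on U)"
proof -
  interpret cring "ring_on U" by (rule cring_ring_on[OF U])
  have inv: "\<ominus>\<^bsub>ring_on U\<^esub> x = - x" if "x \<in> U" for x
    using that subring_setD[OF U] by (intro minus_equality) simp_all
  have "- x \<in> I" if "x \<in> I" for x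
    using m[OF that, of "- 1"] subring_setD[OF U] by simp
  hence "subgroup I (add_monoid (ring_on U))"
    using assms inv by unfold_locales (auto simp: a_inv_def subset_iff)
  thus ?thesis
    using m by (intro idealI ring_axioms) (auto simp: mult.commute)
qed

lemma Idl_ring_on_ideal:
  assumes "subring_set U" "H \<subseteq> U"
  shows "ideal (Idl\<^bsub>ring_on U\<^esub> H) (ring_on U)" "H \<subseteq> Idl\<^bsub>ring_on U\<^esub> H"
proof -
  interpret cring "ring_on U" by (rule cring_ring_on[OF assms(1)])
  show "ideal (Idl\<^bsub>ring_on U\<^esub> H) (ring_on U)" "H \<subseteq> Idl\<^bsub>ring_on U\<^esub> H"
    using genideal_ideal[of H] genideal_self[of H] assms(2) by simp_all
qed

lemma Idl_ring_on_subset: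
  assumes "ideal I (ring_on U)" "H \<subseteq> I"
  shows "Idl\<^bsub>ring_on U\<^esub> H \<subseteq> I"
  using assms unfolding genideal_def by blast

lemma ideals_set_one [simp]: "one (ideals_set M) = carrier M"
  by (simp add: ideals_set_def)

lemma ideal_power_Suc: "ideal_power (ring_on U) I (Suc n) = ideal_prod (ring_on U) (ideal_power (ring_on U) I n) I"
  by (simp add: ideals_set_def)

lemma ideal_power_ideal:
  assumes U: "subring_set U" and I: "ideal I (ring_on U)"
  shows "ideal (ideal_power (ring_on U) I n) (ring_on U)"
proof -
  interpret cring "ring_on U" by (rule cring_ring_on[OF U])
  show ?thesis
  proof (induction n)
    case 0
    show ?case using oneideal by simp
  next
    case (Suc n)
    show ?case unfolding ideal_power_Suc by (rule ideal_prod_is_ideal[OF Suc I])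
  qed
qed

lemma ideal_power_antimono:
  assumes U: "subring_set U" and I: "ideal I (ring_on U)" and "m \<le> n"
  shows "ideal_power (ring_on U) I n \<subseteq> ideal_power (ring_on U) I m"
proof -
  interpret cring "ring_on U" by (rule cring_ring_on[OF U])
  have "ideal_power (ring_on U) I (Suc k) \<subseteq> ideal_power (ring_on U) I k" for k
    unfolding ideal_power_Suc
    using ideal_prod_inter[OF ideal_power_ideal[OF U I] I] by blast
  thus ?thesis using \<open>m \<le> n\<close> by (rule lift_Suc_antimono_le)
qed

lemma ideal_power_mult:
  assumes U: "subring_set U" and I: "ideal I (ring_on U)"
    and x: "x \<in> ideal_power (ring_on U) I m" and y: "y \<in> ideal_power (ring_on U) I n"
  shows "x * y \<in> ideal_power (ring_on U) I (m + n)"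
  using y
proof (induction n arbitrary: y)
  case 0
  thus ?case using ring_on_idealD(5)[OF ideal_power_ideal[OF U I] x] by simp
next
  case (Suc n)
  note P = ring_on_idealD[OF ideal_power_ideal[OF U I]]
  from Suc.prems have "y \<in> ideal_prod (ring_on U) (ideal_power (ring_on U) I n) I"
    by (simp only: ideal_power_Suc)
  thus ?case
  proof (induction y rule: ideal_prod.induct)
    case (prod i j)
    have "(x * i) * j \<in> ideal_power (ring_on U) I (Suc (m + n))"
      unfolding ideal_power_Suc
      using ideal_prod.prod[of "x * i" _ j I "ring_on U"] Suc.IH[OF prod(1)] prod(2) by simp
    thus ?case by (simp add: mult.assoc)
  next
    case (sum a b)
    show ?case using P(3)[OF sum(3,4)] by (simp add: distrib_left)
  qed
qed

lemma ideal_power_power: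
  assumes U: "subring_set U" and I: "ideal I (ring_on U)" and x: "x \<in> I"
  shows "x ^ n \<in> ideal_power (ring_on U) I n"
proof (induction n)
  case 0
  show ?case using subring_setD[OF U] by simp
next
  case (Suc n)
  have "x ^ n * x \<in> ideal_power (ring_on U) I (Suc n)"
    unfolding ideal_power_Suc using ideal_prod.prod[OF Suc x, of "ring_on U"] by simp
  thus ?case by (simp add: mult.commute)
qed

text \<open>For an ideal \<open>Q\<close> of a subring, this is membership in the ideal \<open>Q\<^sup>k T\<close> of the whole ring \<open>T\<close>.
  Splitting off one factor from \<open>Q\<close> at a time is the form in which Leibniz rules can be applied.\<close>

inductive extended_power :: "'b::comm_ring_1 set \<Rightarrow> nat \<Rightarrow> 'b \<Rightarrow> bool" for Q
  where
    zero_exp: "extended_power Q 0 u"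
  | zero: "extended_power Q k 0"
  | mult: "q \<in> Q \<Longrightarrow> extended_power Q k a \<Longrightarrow> extended_power Q (Suc k) (q * a)"
  | add: "extended_power Q k a \<Longrightarrow> extended_power Q k b \<Longrightarrow> extended_power Q k (a + b)"

lemma extended_power_l_mult: "extended_power Q k a \<Longrightarrow> extended_power Q k (u * a)"
proof (induction rule: extended_power.induct)
  case (mult q k a)
  have "extended_power Q (Suc k) (q * (u * a))" by (rule extended_power.mult) fact+
  thus ?case by (simp add: algebra_simps)
qed (auto simp: distrib_left intro: extended_power.intros)

lemma extended_power_r_mult: "extended_power Q k a \<Longrightarrow> extended_power Q k (a * u)"
  using extended_power_l_mult[of Q k a u] by (simp add: mult.commute)

lemma extended_power_uminus: "extended_power Q k a \<Longrightarrow> extended_power Q k (- a)"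
  using extended_power_l_mult[of Q k a "-1"] by simp

lemma extended_power_diff: "extended_power Q k a \<Longrightarrow> extended_power Q k b \<Longrightarrow> extended_power Q k (a - b)"
  using extended_power.add[of Q k a "-b"] extended_power_uminus by auto

lemma extended_power_Suc_subset: "extended_power Q k' a \<Longrightarrow> k' = Suc k \<Longrightarrow> extended_power Q k a"
proof (induction arbitrary: k rule: extended_power.induct)
  case (mult q j a)
  thus ?case by (auto intro: extended_power_l_mult)
qed (auto intro: extended_power.intros)

lemma ideal_power_subset_extended_power:
  "a \<in> ideal_power (ring_on U) Q k \<Longrightarrow> extended_power Q k a"
proof (induction k arbitrary: a)
  case 0
  show ?case by (rule extended_power.zero_exp)
next
  case (Suc k)
  from Suc.prems have "a \<in> ideal_prod (ring_on U) (ideal_power (ring_on U) Q k) Q"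
    by (simp only: ideal_power_Suc)
  thus ?case
  proof (induction a rule: ideal_prod.induct)
    case (prod i j)
    show ?case using extended_power.mult[OF prod(2) Suc.IH[OF prod(1)]] by (simp add: mult.commute)
  next
    case (sum a b)
    thus ?case by (simp add: extended_power.add)
  qed
qed

text \<open>The contraction to \<open>T\<close> of \<open>Q\<^sup>k W\<inverse> T\<close>. With \<open>W = R - Q\<close> it contains the symbolic power \<open>Q\<^sup>(\<^sup>k\<^sup>)\<close>
  of \<open>R\<close>, but it lives in a ring that carries the operators that \<open>R\<close> lacks.\<close>

definition saturated_power :: "'b::comm_ring_1 set \<Rightarrow> 'b set \<Rightarrow> nat \<Rightarrow> 'b set"
  where "saturated_power W Q k = {y. \<exists>s\<in>W. extended_power Q k (s * y)}"

lemma saturated_powerI: "s \<in> W \<Longrightarrow> extended_power Q k (s * y) \<Longrightarrow> y \<in> saturated_power W Q k"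
  by (auto simp: saturated_power_def)

lemma saturated_powerE:
  assumes "y \<in> saturated_power W Q k"
  obtains s where "s \<in> W" "extended_power Q k (s * y)"
  using assms by (auto simp: saturated_power_def)

lemma saturated_power_Suc_subset: "saturated_power W Q (Suc k) \<subseteq> saturated_power W Q k"
  by (auto simp: saturated_power_def intro: extended_power_Suc_subset)

lemma primeideal_complement:
  assumes "primeideal Q (ring_on R)"
  shows "1 \<in> R - Q" "s \<in> R - Q \<Longrightarrow> t \<in> R - Q \<Longrightarrow> s * t \<in> R - Q"
proof -
  interpret primeideal Q "ring_on R" by fact
  have "R \<noteq> Q" using I_notcarr by simp
  thus "1 \<in> R - Q" using one_imp_carrier one_closed by auto
  show "s \<in> R - Q \<Longrightarrow> t \<in> R - Q \<Longrightarrow> s * t \<in> R - Q"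
    using I_prime[of s t] m_closed[of s t] by auto
qed

text \<open>The fractions \<open>y/s\<close> with \<open>y \<in> Q\<^sup>n\<close> and \<open>s \<notin> Q\<close> already form an ideal of \<open>R\<^sub>Q\<close>, so an element of
  the symbolic power is such a fraction; it remains to clear the denominator.\<close>

lemma symbolic_power_subset_saturated_power:
  fixes R Q :: "'b::idom set"
  assumes R: "subring_set R" and Q: "primeideal Q (ring_on R)"
  shows "symbolic_power R Q n \<subseteq> saturated_power (R - Q) Q n"
proof
  fix x assume x: "x \<in> symbolic_power R Q n"
  let ?L = "localization_at R Q" and ?P = "ideal_power (ring_on R) Q n"
  interpret Q: primeideal Q "ring_on R" by fact
  note W = primeideal_complement[OF Q] and R' = subring_setD[OF R]
  note P = ring_on_idealD[OF ideal_power_ideal[OF R Q.is_ideal, of n]]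
  have nz: "s \<noteq> 0" if "s \<in> R - Q" for s
    using that ring_on_idealD(2)[OF Q.is_ideal] by auto
  have LI: "Fraction_Field.Fract a s \<in> ?L" if "a \<in> R" "s \<in> R - Q" for a s
    using that unfolding localization_at_def by blast
  have L: "subring_set ?L"
    unfolding subring_set_def
  proof (intro conjI ballI)
    show "1 \<in> ?L" unfolding localization_at_def using W(1) R'(1)
      by (auto simp: One_fract_def)
  next
    fix y assume "y \<in> ?L"
    thus "- y \<in> ?L" unfolding localization_at_def using R'(3) by force
  next
    fix y z assume "y \<in> ?L" "z \<in> ?L"
    then obtain a s b t where *: "y = Fraction_Field.Fract a s" "z = Fraction_Field.Fract b t"
      "a \<in> R" "b \<in> R" "s \<in> R - Q" "t \<in> R - Q" unfolding localization_at_def by blast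
    have "y + z = Fraction_Field.Fract (a * t + b * s) (s * t)" using * nz by simp
    thus "y + z \<in> ?L" using * R' W(2)[of s t] by (auto intro!: LI)
    have "y * z = Fraction_Field.Fract (a * b) (s * t)" using * nz by simp
    thus "y * z \<in> ?L" using * R' W(2)[of s t] by (auto intro!: LI)
  qed
  define B where "B = {Fraction_Field.Fract y s | y s. y \<in> ?P \<and> s \<in> R - Q}"
  have BI: "Fraction_Field.Fract a s \<in> B" if "a \<in> ?P" "s \<in> R - Q" for a s
    using that unfolding B_def by blast
  have "ideal B (ring_on ?L)"
  proof (rule ring_on_idealI[OF L])
    show "B \<subseteq> ?L" unfolding B_def localization_at_def using P(1) by blast
    show "0 \<in> B" unfolding B_def using P(2) W(1) by (auto simp: Zero_fract_def)
  next
    fix y z assume "y \<in> B" "z \<in> B"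
    then obtain a s b t where *: "y = Fraction_Field.Fract a s" "z = Fraction_Field.Fract b t"
      "a \<in> ?P" "b \<in> ?P" "s \<in> R - Q" "t \<in> R - Q" unfolding B_def by blast
    have "y + z = Fraction_Field.Fract (a * t + b * s) (s * t)" using * nz by simp
    thus "y + z \<in> B" using * P(3,5) W(2)[of s t] by (auto intro!: BI)
  next
    fix y u assume "y \<in> B" "u \<in> ?L"
    then obtain a s b t where *: "y = Fraction_Field.Fract a s" "u = Fraction_Field.Fract b t"
      "a \<in> ?P" "b \<in> R" "s \<in> R - Q" "t \<in> R - Q" unfolding B_def localization_at_def by blast
    have "u * y = Fraction_Field.Fract (b * a) (t * s)" using * nz by simp
    thus "u * y \<in> B" using * P(4) W(2)[of t s] by (auto intro!: BI)
  qed
  moreover have "(\<lambda>y. Fraction_Field.Fract y 1) ` ?P \<subseteq> B" unfolding B_def using W(1) by blast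
  ultimately have "Fraction_Field.Fract x 1 \<in> B"
    using x Idl_ring_on_subset unfolding symbolic_power_def by blast
  then obtain y s where *: "Fraction_Field.Fract x 1 = Fraction_Field.Fract y s" "y \<in> ?P" "s \<in> R - Q"
    unfolding B_def by blast
  hence "s * x = y" using nz[of s] by (simp add: eq_fract mult.commute)
  hence "extended_power Q n (s * x)" using ideal_power_subset_extended_power[OF *(2)] by simp
  thus "x \<in> saturated_power (R - Q) Q n" using *(3) by (rule saturated_powerI[rotated])
qed

section \<open>Derivations and p-derivations on saturated powers\<close>

text \<open>The middle terms of the binomial expansion are divisible by \<open>p\<close> and by \<open>a\<close>. The factor \<open>a\<close> is what
  keeps the correction term in the additivity law of a \<open>p\<close>-derivation inside an ideal containing \<open>a\<close>.\<close>

lemma add_power_prime: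
  fixes a b :: "'b::comm_ring_1"
  assumes p: "Factorial_Ring.prime p"
  obtains c where "(a + b) ^ p = a ^ p + b ^ p + of_nat p * (a * c)"
proof -
  have p1: "p > 1" using p prime_gt_1_nat by blast
  define t where "t k = of_nat (p choose k) * a ^ k * b ^ (p - k)" for k
  have "of_nat p * a dvd t k" if "k \<in> {1..<p}" for k
  proof -
    have "p dvd p choose k" using that p by (intro dvd_choose_prime) (auto simp: p)
    hence "of_nat p dvd (of_nat (p choose k) :: 'b)" by (auto elim!: dvdE)
    moreover have "a dvd a ^ k" using that by (intro dvd_power) auto
    ultimately show ?thesis unfolding t_def by (intro dvd_mult2 mult_dvd_mono)
  qed
  hence "of_nat p * a dvd (\<Sum>k\<in>{1..<p}. t k)" by (rule dvd_sum)
  then obtain c where c: "(\<Sum>k\<in>{1..<p}. t k) = of_nat p * a * c" by blast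
  have "{..p} = insert 0 (insert p {1..<p})" using p1 by auto
  hence "(a + b) ^ p = t 0 + (t p + (\<Sum>k\<in>{1..<p}. t k))"
    using p1 by (simp add: binomial_ring t_def)
  also have "\<dots> = a ^ p + b ^ p + of_nat p * (a * c)"
    unfolding c by (simp add: t_def add_ac mult_ac)
  finally show ?thesis by (rule that)
qed

locale frobenius_lift =
  fixes p :: nat and \<phi> \<delta> :: "'b::idom \<Rightarrow> 'b"
  assumes p: "Factorial_Ring.prime p" and p_nz: "of_nat p \<noteq> (0::'b)"
    and hom: "is_ring_hom \<phi>" and lift: "\<phi> x = x ^ p + of_nat p * \<delta> x"
begin

lemmas \<phi> = is_ring_homD[OF hom]

lemma p_cancel: "of_nat p * x = of_nat p * y \<longleftrightarrow> x = (y::'b)"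
  using p_nz by simp

lemma delta_zero [simp]: "\<delta> 0 = 0"
proof -
  have "p > 0" using p prime_gt_0_nat by blast
  thus ?thesis using lift[of 0] \<phi>(4) p_nz by (simp add: power_0_left)
qed

lemma delta_add:
  obtains c where "\<delta> (a + b) = \<delta> a + \<delta> b - a * c"
proof -
  obtain c where c: "(a + b) ^ p = a ^ p + b ^ p + of_nat p * (a * c)"
    using add_power_prime[OF p] .
  have "of_nat p * \<delta> (a + b) = of_nat p * (\<delta> a + \<delta> b - a * c)"
    using \<phi>(2)[of a b] unfolding lift c by (simp add: algebra_simps)
  thus ?thesis using that[of c] p_cancel by blast
qed

lemma delta_mult: "\<delta> (a * b) = a ^ p * \<delta> b + b ^ p * \<delta> a + of_nat p * (\<delta> a * \<delta> b)"
proof -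
  have "of_nat p * \<delta> (a * b) = of_nat p * (a ^ p * \<delta> b + b ^ p * \<delta> a + of_nat p * (\<delta> a * \<delta> b))"
    using \<phi>(3)[of a b] unfolding lift by (simp add: algebra_simps power_mult_distrib)
  thus ?thesis using p_cancel by blast
qed

lemma power_p: "a ^ p = a * a ^ (p - 1)"
  using p prime_gt_0_nat[of p] by (simp flip: power_Suc)

text \<open>In \<open>\<delta>(q a) = q\<^sup>p \<delta>(a) + a\<^sup>p \<delta>(q) + p \<delta>(q) \<delta>(a)\<close> each of the first two terms loses at
  most one factor from \<open>Q\<close>. The third may lose two, and \<open>p \<in> Q\<close> makes up for one of them.\<close>

lemma delta_extended_power:
  assumes pQ: "of_nat p \<in> Q"
  shows "extended_power Q k a \<Longrightarrow> k = Suc j \<Longrightarrow> extended_power Q j (\<delta> a)"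
proof (induction arbitrary: j rule: extended_power.induct)
  case (mult q k a)
  show ?case
  proof (cases k)
    case 0
    thus ?thesis using mult by (auto intro: extended_power.zero_exp)
  next
    case (Suc i)
    hence da: "extended_power Q i (\<delta> a)" using mult.IH by simp
    have "extended_power Q k (q * (q ^ (p - 1) * \<delta> a))"
      unfolding Suc by (intro extended_power.mult mult.hyps extended_power_l_mult da)
    moreover have "extended_power Q k (a * (a ^ (p - 1) * \<delta> q))"
      by (intro extended_power_r_mult mult.hyps)
    moreover have "extended_power Q k (of_nat p * (\<delta> q * \<delta> a))"
      unfolding Suc by (intro extended_power.mult pQ extended_power_l_mult da)
    ultimately have "extended_power Q k (\<delta> (q * a))"
      unfolding delta_mult power_p[of q] power_p[of a] mult.assoc
      by (intro extended_power.add)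
    thus ?thesis using mult by simp
  qed
next
  case (add k a b)
  obtain c where c: "\<delta> (a + b) = \<delta> a + \<delta> b - a * c" by (rule delta_add)
  have "extended_power Q j (a * c)"
    using add by (blast intro: extended_power_Suc_subset extended_power_r_mult)
  thus ?case unfolding c using add by (blast intro: extended_power_diff extended_power.add)
qed (auto intro: extended_power.intros)

text \<open>In \<open>\<delta>(s y) = s\<^sup>p \<delta>(y) + y\<^sup>p \<delta>(s) + p \<delta>(s) \<delta>(y)\<close> the second term becomes a multiple of \<open>s y\<close> after
  multiplication by \<open>s\<^sup>p\<close>. The third one is handled by induction: \<open>\<delta>(y)\<close> is already known to lie one
  step lower, and \<open>p \<in> Q\<close> makes up for it.\<close>

lemma delta_saturated_power:
  assumes pQ: "of_nat p \<in> Q" and W1: "1 \<in> W" and Wm: "\<And>s t. s \<in> W \<Longrightarrow> t \<in> W \<Longrightarrow> s * t \<in> W"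
  shows "y \<in> saturated_power W Q (Suc k) \<Longrightarrow> \<delta> y \<in> saturated_power W Q k"
proof (induction k)
  case 0
  show ?case by (rule saturated_powerI[OF W1]) (rule extended_power.zero_exp)
next
  case (Suc k)
  have Wp: "s ^ n \<in> W" if "s \<in> W" for s n by (induction n) (auto intro: W1 Wm that)
  obtain s where s: "s \<in> W" "extended_power Q (Suc (Suc k)) (s * y)"
    using Suc.prems by (rule saturated_powerE)
  have "\<delta> y \<in> saturated_power W Q k"
    using Suc saturated_power_Suc_subset by blast
  then obtain t where t: "t \<in> W" "extended_power Q k (t * \<delta> y)" by (rule saturated_powerE)
  have "extended_power Q (Suc k) (t * s ^ p * \<delta> (s * y))"
    by (intro extended_power_l_mult delta_extended_power[OF pQ s(2)]) simp
  moreover have "extended_power Q (Suc k) ((s * y) * ((s * y) ^ (p - 1) * (t * \<delta> s)))"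
    by (intro extended_power_r_mult extended_power_Suc_subset[OF s(2) refl])
  moreover have "extended_power Q (Suc k) (of_nat p * (s ^ p * \<delta> s * (t * \<delta> y)))"
    by (intro extended_power.mult pQ extended_power_l_mult t)
  \<comment> \<open>the multiplier \<open>s\<^sup>p\<close> turns \<open>y\<^sup>p\<close> into \<open>(s y)\<^sup>p\<close>, and \<open>t\<close> brings \<open>\<delta>(y)\<close> into \<open>Q\<^sup>k T\<close>\<close>
  ultimately have "extended_power Q (Suc k) (t * s ^ p * \<delta> (s * y)
      - (s * y) * ((s * y) ^ (p - 1) * (t * \<delta> s)) - of_nat p * (s ^ p * \<delta> s * (t * \<delta> y)))"
    by (intro extended_power_diff)
  also have "(s * y) * ((s * y) ^ (p - 1) * (t * \<delta> s)) = (s * y) ^ p * (t * \<delta> s)"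
    by (simp only: power_p[of "s * y"] mult.assoc)
  also have "t * s ^ p * \<delta> (s * y) - (s * y) ^ p * (t * \<delta> s) - of_nat p * (s ^ p * \<delta> s * (t * \<delta> y))
      = (t * (s ^ p * s ^ p)) * \<delta> y"
    by (simp add: delta_mult power_mult_distrib algebra_simps)
  finally show ?case by (rule saturated_powerI[rotated]) (intro Wm Wp s(1) t(1))
qed

text \<open>The order of \<open>y\<close> in \<open>p\<close> drops by at most one under \<open>\<delta>\<close>. If \<open>y = p\<^sup>i u\<close> with \<open>i \<ge> 1\<close>, then
  \<open>p \<delta>(y) = p\<^sup>i \<phi>(u) - p\<^sup>i\<^sup>p u\<^sup>p\<close> and the last term is divisible by \<open>p\<^sup>i\<^sup>+\<^sup>1\<close>, so further divisibility of
  \<open>\<delta>(y)\<close> forces \<open>p\<close> to divide \<open>\<phi>(u)\<close>.\<close>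

lemma power_dvd_of_delta:
  assumes reflect: "\<And>u. of_nat p dvd \<phi> u \<Longrightarrow> of_nat p dvd u"
    and y: "of_nat p dvd y" and dy: "of_nat p ^ k dvd \<delta> y"
  shows "of_nat p ^ Suc k dvd y"
proof -
  have "of_nat p ^ Suc i dvd y" if "i \<le> k" for i
    using that
  proof (induction i)
    case 0
    show ?case using y by simp
  next
    case (Suc i)
    then obtain u where u: "y = of_nat p ^ Suc i * u" by (auto elim: dvdE)
    have "2 \<le> p" using p by (rule prime_ge_2_nat)
    hence "Suc (Suc i) \<le> Suc i * p"
      using mult_le_mono2[of 2 p "Suc i"] by simp
    hence "of_nat p ^ Suc (Suc i) dvd (of_nat p ^ (Suc i * p) :: 'b)" by (rule le_imp_power_dvd)
    also have "\<dots> dvd y ^ p" by (simp only: u power_mult_distrib power_mult dvd_triv_left)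
    finally have 1: "of_nat p ^ Suc (Suc i) dvd y ^ p" .
    have "of_nat p ^ Suc i dvd \<delta> y"
      using dy Suc.prems by (meson dvd_trans le_imp_power_dvd)
    hence "of_nat p ^ Suc (Suc i) dvd of_nat p * \<delta> y" by (simp add: mult_dvd_mono)
    with 1 have "of_nat p ^ Suc (Suc i) dvd \<phi> y" unfolding lift by (rule dvd_add)
    also have "\<phi> y = of_nat p ^ Suc i * \<phi> u" by (simp only: u \<phi>)
    finally have "of_nat p ^ Suc i * of_nat p dvd of_nat p ^ Suc i * \<phi> u"
      by (simp add: mult.commute)
    hence "of_nat p dvd \<phi> u" using p_nz by (subst (asm) dvd_mult_cancel_left) simp
    hence "of_nat p dvd u" by (rule reflect)
    thus ?case unfolding u by (simp add: mult_dvd_mono mult.commute mult.left_commute)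
  qed
  thus ?thesis by blast
qed

end

lemma derivation_extended_power:
  fixes d :: "'b::comm_ring_1 \<Rightarrow> 'b"
  assumes da: "\<And>x y. d (x + y) = d x + d y" and dm: "\<And>x y. d (x * y) = d x * y + x * d y"
  shows "extended_power Q k a \<Longrightarrow> k = Suc j \<Longrightarrow> extended_power Q j (d a)"
proof (induction arbitrary: j rule: extended_power.induct)
  case (zero k)
  have "d 0 = 0" using da[of 0 0] by simp
  thus ?case by (simp add: extended_power.zero)
next
  case (mult q k a)
  have "extended_power Q k (q * d a)"
    using mult by (cases k) (auto intro: extended_power.intros)
  moreover have "extended_power Q k (d q * a)" using mult by (blast intro: extended_power_l_mult)
  ultimately show ?case using mult by (auto simp: dm intro: extended_power.add)
next
  case (add k a b)
  thus ?case by (auto simp: da intro: extended_power.add)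
qed (auto intro: extended_power.intros)

text \<open>Multiply \<open>d(s y) = s d(y) + y d(s)\<close> by \<open>s\<close>, so that \<open>y\<close> occurs only within \<open>s y\<close> in the terms to be
  subtracted.\<close>

lemma derivation_saturated_power:
  fixes d :: "'b::comm_ring_1 \<Rightarrow> 'b"
  assumes da: "\<And>x y. d (x + y) = d x + d y" and dm: "\<And>x y. d (x * y) = d x * y + x * d y"
    and Wm: "\<And>s t. s \<in> W \<Longrightarrow> t \<in> W \<Longrightarrow> s * t \<in> W"
    and y: "y \<in> saturated_power W Q (Suc k)"
  shows "d y \<in> saturated_power W Q k"
proof -
  obtain s where s: "s \<in> W" "extended_power Q (Suc k) (s * y)" using y by (rule saturated_powerE)
  have "extended_power Q k (s * d (s * y))"
    by (intro extended_power_l_mult derivation_extended_power[OF da dm s(2)]) auto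
  moreover have "extended_power Q k (d s * (s * y))"
    by (rule extended_power_l_mult) (rule extended_power_Suc_subset[OF s(2) refl])
  ultimately have "extended_power Q k (s * d (s * y) - d s * (s * y))"
    by (rule extended_power_diff)
  also have "s * d (s * y) - d s * (s * y) = (s * s) * d y" by (simp add: dm algebra_simps)
  finally show ?thesis by (rule saturated_powerI[rotated]) (intro Wm s(1))
qed

section \<open>Frobenius lifts, derivatives and slices of polynomials\<close>

lemma lookup_mconst_mult:
  "Poly_Mapping.lookup (mconst a * y) \<alpha> = (a::'a::comm_ring_1) * Poly_Mapping.lookup y \<alpha>"
  by (induction y rule: poly_mapping_singles_induct)
     (simp_all add: mult_single lookup_single when_def lookup_add distrib_left)

lemma lookup_of_nat_mult:
  "Poly_Mapping.lookup (of_nat n * y) \<alpha> = of_nat n * Poly_Mapping.lookup (y :: 'a::comm_ring_1 mpoly) \<alpha>"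
  using lookup_mconst_mult[of "of_nat n" y \<alpha>] by simp

lemma of_nat_dvd_mpoly_iff:
  fixes y :: "'a::comm_ring_1 mpoly"
  shows "of_nat n dvd y \<longleftrightarrow> (\<forall>\<alpha>. of_nat n dvd Poly_Mapping.lookup y \<alpha>)"
proof
  assume "of_nat n dvd y"
  thus "\<forall>\<alpha>. of_nat n dvd Poly_Mapping.lookup y \<alpha>"
    by (auto elim!: dvdE simp: lookup_of_nat_mult)
next
  assume *: "\<forall>\<alpha>. of_nat n dvd Poly_Mapping.lookup y \<alpha>"
  have "of_nat n dvd Poly_Mapping.single \<alpha> (Poly_Mapping.lookup y \<alpha>)" for \<alpha>
  proof -
    obtain c where "Poly_Mapping.lookup y \<alpha> = of_nat n * c" using * by blast
    hence "Poly_Mapping.single \<alpha> (Poly_Mapping.lookup y \<alpha>) = of_nat n * Poly_Mapping.single \<alpha> c"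
      using mult_single[of 0 "of_nat n" \<alpha> c] by simp
    thus ?thesis by simp
  qed
  thus "of_nat n dvd y"
    by (subst poly_mapping_eq_sum_singles) (intro dvd_sum)
qed

lemma of_nat_mpoly_nonzero:
  assumes "of_nat n \<noteq> (0::'a::comm_ring_1)"
  shows "of_nat n \<noteq> (0 :: 'a mpoly)"
  using assms lookup_of_nat_mult[of n "1::'a mpoly" 0] by (auto simp: lookup_one)

text \<open>A lift of Frobenius extends to polynomials with arbitrary values congruent to \<open>X\<^sub>i\<^sup>p\<close> at the variables,
  because the elements \<open>x\<close> with \<open>\<phi> x \<equiv> x\<^sup>p\<close> modulo \<open>p\<close> form a subring.\<close>

lemma frobenius_lift_mpoly:
  fixes g :: "nat \<Rightarrow> 'a::idom mpoly"
  assumes A: "frobenius_lift p \<phi> \<delta>"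
  shows "\<exists>\<delta>'. frobenius_lift p (mpoly_eval (\<lambda>c. mconst (\<phi> c)) (\<lambda>i. Var i ^ p + of_nat p * g i)) \<delta>'"
proof -
  interpret A: frobenius_lift p \<phi> \<delta> by fact
  define \<Phi> where "\<Phi> = mpoly_eval (\<lambda>c. mconst (\<phi> c)) (\<lambda>i. Var i ^ p + of_nat p * g i)"
  have h: "is_ring_hom (\<lambda>c. mconst (\<phi> c) :: 'a mpoly)"
    by (rule is_ring_hom_comp[OF is_ring_hom_mconst A.hom])
  have hom: "is_ring_hom \<Phi>" unfolding \<Phi>_def by (rule mpoly_eval_ring_hom[OF h])
  note \<Phi> = is_ring_homD[OF hom]
  have "\<exists>d. \<Phi> x = x ^ p + of_nat p * d" for x
  proof (induction x rule: mpoly_ring_induct)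
    case (const c)
    have "mconst (\<phi> c) = mconst c ^ p + of_nat p * mconst (\<delta> c)"
      using is_ring_homD[OF is_ring_hom_mconst] by (metis A.lift)
    thus ?case unfolding \<Phi>_def mpoly_eval_mconst[OF h] by blast
  next
    case (var i)
    show ?case unfolding \<Phi>_def mpoly_eval_Var[OF h] by blast
  next
    case (add x y)
    then obtain d e where "\<Phi> x = x ^ p + of_nat p * d" "\<Phi> y = y ^ p + of_nat p * e" by blast
    moreover obtain c where "(x + y) ^ p = x ^ p + y ^ p + of_nat p * (x * c)"
      by (rule add_power_prime[OF A.p])
    ultimately have "\<Phi> (x + y) = (x + y) ^ p + of_nat p * (d + e - x * c)"
      by (simp add: \<Phi> algebra_simps)
    thus ?case by blast
  next
    case (mult x y)
    then obtain d e where "\<Phi> x = x ^ p + of_nat p * d" "\<Phi> y = y ^ p + of_nat p * e" by blast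
    hence "\<Phi> (x * y) = (x * y) ^ p + of_nat p * (x ^ p * e + y ^ p * d + of_nat p * (d * e))"
      by (simp add: \<Phi> power_mult_distrib algebra_simps)
    thus ?case by blast
  qed
  then obtain \<delta>' where "\<And>x. \<Phi> x = x ^ p + of_nat p * \<delta>' x" by metis
  hence "frobenius_lift p \<Phi> \<delta>'"
    by unfold_locales (use A.p A.p_nz hom of_nat_mpoly_nonzero in auto)
  thus ?thesis unfolding \<Phi>_def by blast
qed

text \<open>Distinct monomials do not interfere: the image of \<open>u\<close> has at \<open>n \<alpha>\<close> the value of \<open>\<phi>\<close> at the
  coefficient of \<open>u\<close> at \<open>\<alpha>\<close>.\<close>

lemma frobenius_mpoly_reflects_dvd:
  fixes \<phi> :: "'a::comm_ring_1 \<Rightarrow> 'a"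
  assumes hom: "is_ring_hom \<phi>" and n: "n > 0" and reflect: "\<And>c. of_nat p dvd \<phi> c \<Longrightarrow> of_nat p dvd c"
    and dvd: "of_nat p dvd mpoly_eval (\<lambda>c. mconst (\<phi> c)) (\<lambda>i. Var i ^ n) u"
  shows "of_nat p dvd u"
proof -
  have h: "is_ring_hom (\<lambda>c. mconst (\<phi> c) :: 'a mpoly)"
    by (rule is_ring_hom_comp[OF is_ring_hom_mconst hom])
  define \<Phi> where "\<Phi> = mpoly_eval (\<lambda>c. mconst (\<phi> c) :: 'a mpoly) (\<lambda>i. Var i ^ n)"
  note \<Phi> = is_ring_homD[OF mpoly_eval_ring_hom[OF h], of "\<lambda>i. Var i ^ n", folded \<Phi>_def]
  define sc where "sc \<alpha> = (\<Sum>i<n. \<alpha> :: nat \<Rightarrow>\<^sub>0 nat)" for \<alpha>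
  have sc_lookup: "Poly_Mapping.lookup (sc \<alpha>) i = n * Poly_Mapping.lookup \<alpha> i" for \<alpha> i
    unfolding sc_def lookup_sum by simp
  have sc_inj: "sc \<alpha> = sc \<beta> \<longleftrightarrow> \<alpha> = \<beta>" for \<alpha> \<beta>
    using n sc_lookup by (metis mult_cancel1 not_gr_zero poly_mapping_eqI)
  have "monom_eval (\<lambda>i. Var i ^ n) \<alpha> = (monom_eval Var \<alpha> :: 'a mpoly) ^ n" for \<alpha>
    by (simp add: monom_eval_def prod_power_distrib mult.commute flip: power_mult)
  hence mono: "monom_eval (\<lambda>i. Var i ^ n) \<alpha> = (Poly_Mapping.single (sc \<alpha>) 1 :: 'a mpoly)" for \<alpha>
    unfolding single_one_eq_monom_eval[symmetric] single_one_power sc_def .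
  have "Poly_Mapping.lookup (\<Phi> f) (sc \<alpha>) = \<phi> (Poly_Mapping.lookup f \<alpha>)" for f \<alpha>
  proof (induction f rule: poly_mapping_singles_induct)
    case (single \<beta> c)
    show ?case unfolding \<Phi>_def mpoly_eval_single[OF h] mono lookup_mconst_mult
      by (simp add: lookup_single when_def sc_inj is_ring_homD[OF hom])
  qed (simp_all add: \<Phi> lookup_add is_ring_homD[OF hom])
  thus ?thesis using dvd reflect unfolding of_nat_dvd_mpoly_iff \<Phi>_def[symmetric] by metis
qed

text \<open>The chart \<open>x\<^sub>i \<mapsto> p z\<^sub>i\<close> of the blowup of the ideal \<open>(p, x\<^sub>1, \<dots>, x\<^sub>m)\<close>, in which membership in the \<open>k\<close>-th
  power of that ideal becomes divisibility by \<open>p\<^sup>k\<close>. In the source \<open>z\<^sub>i\<close> is the variable \<open>X\<^sub>m\<^sub>+\<^sub>i\<close>; in the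
  target it is renamed to \<open>X\<^sub>i\<close>, so that coefficients of elements of \<open>S\<close> stay at their exponents.\<close>

definition blowup :: "nat \<Rightarrow> nat \<Rightarrow> 'a::comm_ring_1 mpoly \<Rightarrow> 'a mpoly"
  where "blowup p m = mpoly_eval mconst (\<lambda>i. if i \<in> {1..m} then of_nat p * Var i else Var (i - m))"

lemma blowup_ring_hom: "is_ring_hom (blowup p m)"
  unfolding blowup_def by (rule mpoly_eval_ring_hom[OF is_ring_hom_mconst])

lemma of_nat_dvd_blowup:
  fixes y :: "'a::comm_ring_1 mpoly"
  assumes "\<And>\<gamma>. Poly_Mapping.keys \<gamma> \<inter> {1..m} = {} \<Longrightarrow> of_nat p dvd Poly_Mapping.lookup y \<gamma>"
  shows "of_nat p dvd blowup p m y"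
  unfolding blowup_def mpoly_eval_def lin_ext_def
proof (rule dvd_sum)
  fix \<alpha>
  let ?g = "\<lambda>i. if i \<in> {1..m} then of_nat p * Var i else (Var (i - m) :: 'a mpoly)"
  show "of_nat p dvd mconst (Poly_Mapping.lookup y \<alpha>) * monom_eval ?g \<alpha>"
  proof (cases "Poly_Mapping.keys \<alpha> \<inter> {1..m} = {}")
    case True
    then obtain c where "Poly_Mapping.lookup y \<alpha> = of_nat p * c" using assms by blast
    thus ?thesis by (simp add: mconst_mult)
  next
    case False
    then obtain i where i: "i \<in> Poly_Mapping.keys \<alpha>" "i \<in> {1..m}" by blast
    have "of_nat p dvd ?g i" using i by simp
    also have "?g i dvd ?g i ^ Poly_Mapping.lookup \<alpha> i"
      using i by (intro dvd_power) (auto simp: in_keys_iff)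
    also have "\<dots> dvd monom_eval ?g \<alpha>"
      unfolding monom_eval_def using i by (intro dvd_prodI) auto
    finally show ?thesis by (rule dvd_mult)
  qed
qed

abbreviation total_degree :: "(nat \<Rightarrow>\<^sub>0 nat) \<Rightarrow> nat"
  where "total_degree \<equiv> weighted_degree (\<lambda>_. 1)"

lemma weighted_degree_add: "weighted_degree w (\<alpha> + \<beta>) = weighted_degree w \<alpha> + weighted_degree w \<beta>"
  unfolding weighted_degree_def by (rule setsum_keys_plus_distrib) (auto simp: algebra_simps)

lemma weighted_degree_zero [simp]: "weighted_degree w 0 = 0"
  by (simp add: weighted_degree_def)

lemma weighted_degree_single: "weighted_degree w (Poly_Mapping.single i n) = n * w i"
  by (simp add: weighted_degree_def)

lemma lookup_blowup:
  fixes f :: "'a::comm_ring_1 mpoly"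
  assumes "f \<in> polynomials m"
  shows "Poly_Mapping.lookup (blowup p m f) \<alpha> = of_nat p ^ total_degree \<alpha> * Poly_Mapping.lookup f \<alpha>"
proof (induction f rule: poly_mapping_singles_induct)
  case (single \<beta> c)
  have k: "Poly_Mapping.keys \<beta> \<subseteq> {1..m}" using assms single by (auto simp: polynomials_def)
  let ?g = "\<lambda>i. if i \<in> {1..m} then of_nat p * Var i else (Var (i - m) :: 'a mpoly)"
  have "monom_eval ?g \<beta> = (\<Prod>i\<in>Poly_Mapping.keys \<beta>. of_nat p ^ Poly_Mapping.lookup \<beta> i * Var i ^ Poly_Mapping.lookup \<beta> i)"
    unfolding monom_eval_def by (rule prod.cong) (use k in \<open>auto simp: power_mult_distrib\<close>)
  also have "\<dots> = of_nat p ^ total_degree \<beta> * monom_eval Var \<beta>"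
    by (simp add: prod.distrib monom_eval_def weighted_degree_def power_sum)
  finally have "monom_eval ?g \<beta> = of_nat (p ^ total_degree \<beta>) * Poly_Mapping.single \<beta> 1"
    by (simp add: single_one_eq_monom_eval)
  thus ?case
    unfolding blowup_def mpoly_eval_single[OF is_ring_hom_mconst] lookup_mconst_mult
    by (simp only: lookup_of_nat_mult) (simp add: lookup_single when_def)
qed (simp_all add: is_ring_homD[OF blowup_ring_hom] lookup_add distrib_left)

text \<open>The truncated subtraction of exponents is harmless: where it truncates, the coefficient is zero.\<close>

definition partial_deriv :: "nat \<Rightarrow> 'a::comm_ring_1 mpoly \<Rightarrow> 'a mpoly"
  where "partial_deriv i = lin_ext (\<lambda>\<alpha> c. Poly_Mapping.single (\<alpha> - Poly_Mapping.single i 1) (of_nat (Poly_Mapping.lookup \<alpha> i) * c))"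

lemma partial_deriv_single:
  "partial_deriv i (Poly_Mapping.single \<alpha> c) =
    Poly_Mapping.single (\<alpha> - Poly_Mapping.single i 1) (of_nat (Poly_Mapping.lookup \<alpha> i) * c)"
  by (simp add: partial_deriv_def lin_ext_single)

lemma partial_deriv_add: "partial_deriv i (f + g) = partial_deriv i f + partial_deriv i g"
  unfolding partial_deriv_def by (rule lin_ext_add) (simp_all add: distrib_left single_add)

lemma partial_deriv_zero [simp]: "partial_deriv i 0 = 0"
  by (simp add: partial_deriv_def)

lemma lookup_partial_deriv:
  "Poly_Mapping.lookup (partial_deriv i f) \<beta> =
    of_nat (Suc (Poly_Mapping.lookup \<beta> i)) * Poly_Mapping.lookup f (\<beta> + Poly_Mapping.single i 1)"
proof (induction f rule: poly_mapping_singles_induct)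
  case (single \<alpha> c)
  let ?e = "Poly_Mapping.single i (1::nat)"
  show ?case
  proof (cases "Poly_Mapping.lookup \<alpha> i = 0")
    case True
    hence "\<alpha> \<noteq> \<beta> + ?e" by (auto simp: lookup_add)
    thus ?thesis using True by (simp add: partial_deriv_single lookup_single)
  next
    case False
    hence "\<alpha> = (\<alpha> - ?e) + ?e"
      by (intro poly_mapping_eqI) (auto simp: lookup_add lookup_minus lookup_single when_def)
    hence "\<alpha> - ?e = \<beta> \<longleftrightarrow> \<alpha> = \<beta> + ?e" by (metis add_diff_cancel_right')
    thus ?thesis by (auto simp: partial_deriv_single lookup_single when_def lookup_add)
  qed
qed (simp_all add: partial_deriv_add lookup_add distrib_left)

lemma partial_deriv_mult: "partial_deriv i (f * g) = partial_deriv i f * g + f * partial_deriv i g"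
proof (induction f rule: poly_mapping_singles_induct)
  case (single \<alpha> a)
  show ?case
  proof (induction g rule: poly_mapping_singles_induct)
    case (single \<beta> b)
    let ?e = "Poly_Mapping.single i (1::nat)"
    have 1: "Poly_Mapping.single (\<alpha> + \<beta> - ?e) (of_nat (Poly_Mapping.lookup \<alpha> i) * c)
        = Poly_Mapping.single (\<alpha> - ?e + \<beta>) (of_nat (Poly_Mapping.lookup \<alpha> i) * c)" for \<alpha> \<beta> and c :: 'a
    proof (cases "Poly_Mapping.lookup \<alpha> i = 0")
      case False
      hence "\<alpha> + \<beta> - ?e = \<alpha> - ?e + \<beta>"
        by (intro poly_mapping_eqI) (auto simp: lookup_add lookup_minus lookup_single when_def)
      thus ?thesis by simp
    qed simp
    show ?case
      using 1[of \<alpha> \<beta> "a * b"] 1[of \<beta> \<alpha> "a * b"]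
      by (simp add: mult_single partial_deriv_single lookup_add distrib_right single_add
          mult.assoc mult.left_commute add_ac distrib_left)
  qed (simp_all add: partial_deriv_add distrib_left algebra_simps)
qed (simp_all add: partial_deriv_add algebra_simps)

definition restrict_exponent :: "nat set \<Rightarrow> (nat \<Rightarrow>\<^sub>0 nat) \<Rightarrow> nat \<Rightarrow>\<^sub>0 nat"
  where "restrict_exponent A = Poly_Mapping.mapp (\<lambda>i n. if i \<in> A then n else 0)"

lemma lookup_restrict_exponent:
  "Poly_Mapping.lookup (restrict_exponent A \<alpha>) i = (if i \<in> A then Poly_Mapping.lookup \<alpha> i else 0)"
  by (simp add: restrict_exponent_def lookup_mapp when_def in_keys_iff)

lemma restrict_exponent_add:
  "restrict_exponent A (\<alpha> + \<beta>) = restrict_exponent A \<alpha> + restrict_exponent A \<beta>"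
  by (rule poly_mapping_eqI) (simp add: lookup_restrict_exponent lookup_add)

lemma restrict_exponent_id: "Poly_Mapping.keys \<alpha> \<subseteq> A \<Longrightarrow> restrict_exponent A \<alpha> = \<alpha>"
  by (rule poly_mapping_eqI) (auto simp: lookup_restrict_exponent in_keys_iff)

lemma restrict_exponent_disjoint: "Poly_Mapping.keys \<alpha> \<inter> A = {} \<Longrightarrow> restrict_exponent A \<alpha> = 0"
  by (rule poly_mapping_eqI) (auto simp: lookup_restrict_exponent in_keys_iff)

text \<open>With \<open>T\<close> viewed as a polynomial ring over \<open>S = A[x\<^sub>1, \<dots>, x\<^sub>m]\<close> in all other variables, this is the
  coefficient in \<open>S\<close> of the monomial \<open>\<gamma>\<close>. It is \<open>S\<close>-linear, hence extends maps defined on \<open>S\<close> only.\<close>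

definition slice :: "nat \<Rightarrow> (nat \<Rightarrow>\<^sub>0 nat) \<Rightarrow> 'a::comm_ring_1 mpoly \<Rightarrow> 'a mpoly"
  where "slice m \<gamma> = lin_ext (\<lambda>\<alpha> c. if restrict_exponent (- {1..m}) \<alpha> = \<gamma>
     then Poly_Mapping.single (restrict_exponent {1..m} \<alpha>) c else 0)"

lemma slice_single: "slice m \<gamma> (Poly_Mapping.single \<alpha> c) =
    (if restrict_exponent (- {1..m}) \<alpha> = \<gamma> then Poly_Mapping.single (restrict_exponent {1..m} \<alpha>) c else 0)"
  by (simp add: slice_def lin_ext_single)

lemma slice_add: "slice m \<gamma> (f + g) = slice m \<gamma> f + slice m \<gamma> g"
  unfolding slice_def by (rule lin_ext_add) (simp_all add: single_add)

lemma slice_zero [simp]: "slice m \<gamma> 0 = 0"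
  by (simp add: slice_def)

lemma polynomials_zero [simp]: "0 \<in> polynomials m"
  by (simp add: polynomials_def)

lemma polynomials_add: "f \<in> polynomials m \<Longrightarrow> g \<in> polynomials m \<Longrightarrow> f + g \<in> polynomials m"
  using keys_add[of f g] by (auto simp: polynomials_def)

lemma single_in_polynomials: "Poly_Mapping.keys \<alpha> \<subseteq> {1..m} \<Longrightarrow> Poly_Mapping.single \<alpha> c \<in> polynomials m"
  by (simp add: polynomials_def)

lemma slice_in_polynomials: "slice m \<gamma> f \<in> polynomials m"
proof (induction f rule: poly_mapping_singles_induct)
  case (single \<alpha> c)
  have "Poly_Mapping.keys (restrict_exponent {1..m} \<alpha>) \<subseteq> {1..m}"
    by (auto simp: in_keys_iff lookup_restrict_exponent split: if_splits)
  thus ?case by (simp add: slice_single single_in_polynomials)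
qed (simp_all add: slice_add polynomials_add)

lemma slice_mult:
  assumes "r \<in> polynomials m"
  shows "slice m \<gamma> (r * f) = r * slice m \<gamma> f"
proof (induction r rule: poly_mapping_singles_induct)
  case (single \<mu> a)
  hence "Poly_Mapping.keys \<mu> \<subseteq> {1..m}" using assms by (auto simp: polynomials_def)
  hence *: "restrict_exponent {1..m} \<mu> = \<mu>" "restrict_exponent (- {1..m}) \<mu> = 0"
    by (auto intro!: restrict_exponent_id restrict_exponent_disjoint)
  show ?case
    by (induction f rule: poly_mapping_singles_induct)
       (simp_all add: mult_single slice_single restrict_exponent_add * *[simplified] slice_add distrib_left)
qed (simp_all add: slice_add algebra_simps)

lemma lookup_slice_0:
  assumes "Poly_Mapping.keys \<gamma> \<inter> {1..m} = {}"
  shows "Poly_Mapping.lookup (slice m \<gamma> f) 0 = Poly_Mapping.lookup f \<gamma>"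
proof (induction f rule: poly_mapping_singles_induct)
  case (single \<alpha> c)
  have "restrict_exponent (- {1..m}) \<gamma> = \<gamma>" "restrict_exponent {1..m} \<gamma> = 0"
    using assms by (auto intro!: restrict_exponent_id restrict_exponent_disjoint)
  moreover have "\<alpha> = restrict_exponent (- {1..m}) \<alpha> + restrict_exponent {1..m} \<alpha>"
    by (rule poly_mapping_eqI) (simp add: lookup_add lookup_restrict_exponent)
  ultimately have "restrict_exponent (- {1..m}) \<alpha> = \<gamma> \<and> restrict_exponent {1..m} \<alpha> = 0 \<longleftrightarrow> \<alpha> = \<gamma>"
    by (metis add.right_neutral)
  thus ?case by (auto simp: slice_single lookup_single when_def)
qed (simp_all add: slice_add lookup_add)

section \<open>The valuation ring\<close>

lemma uniformizer_dvd_or_comaximal: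
  fixes u :: "'a::comm_ring_1"
  assumes "uniformizer (ring_of_type_algebra :: 'a ring) u"
  shows "\<not> u dvd 1" "u dvd c \<or> (\<exists>x y. x * c + y * u = 1)"
proof -
  let ?A = "ring_of_type_algebra :: 'a ring"
  interpret A: cring ?A by (rule cring_from_type_algebra)
  interpret M: maximalideal "Idl\<^bsub>?A\<^esub> {u}" ?A using assms by (simp add: uniformizer_def)
  have Idl: "Idl\<^bsub>?A\<^esub> {u} = {x. u dvd x}"
    using A.cgenideal_eq_genideal[of u] by (auto simp: cgenideal_def dvd_def mult.commute)
  show "\<not> u dvd 1"
  proof
    assume "u dvd 1"
    hence "Idl\<^bsub>?A\<^esub> {u} = carrier ?A" unfolding Idl using dvd_trans[OF _ one_dvd] by auto
    thus False using M.I_notcarr by simp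
  qed
  define J where "J = {x * c + y * u | x y. True}"
  have JI: "x * c + y * u \<in> J" for x y unfolding J_def by blast
  have "ideal J (ring_on UNIV)"
  proof (rule ring_on_idealI)
    show "subring_set (UNIV :: 'a set)" by (simp add: subring_set_def)
    show "0 \<in> J" using JI[of 0 0] by simp
  next
    fix a b assume "a \<in> J" "b \<in> J"
    then obtain x y x' y' where "a = x * c + y * u" "b = x' * c + y' * u" unfolding J_def by blast
    thus "a + b \<in> J" using JI[of "x + x'" "y + y'"] by (simp add: algebra_simps)
  next
    fix a v assume "a \<in> J"
    then obtain x y where "a = x * c + y * u" unfolding J_def by blast
    thus "v * a \<in> J" using JI[of "v * x" "v * y"] by (simp add: algebra_simps)
  qed simp
  moreover have "ring_on UNIV = ?A" by (simp add: ring_of_type_algebra_def)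
  ultimately have "ideal J ?A" by simp
  moreover have "Idl\<^bsub>?A\<^esub> {u} \<subseteq> J"
  proof
    fix x assume "x \<in> Idl\<^bsub>?A\<^esub> {u}"
    then obtain y where "x = u * y" unfolding Idl by blast
    thus "x \<in> J" using JI[of 0 y] by (simp add: mult.commute)
  qed
  ultimately consider "J = Idl\<^bsub>?A\<^esub> {u}" | "J = UNIV" using M.I_maximal[of J] by auto
  thus "u dvd c \<or> (\<exists>x y. x * c + y * u = 1)"
  proof cases
    case 1
    thus ?thesis using JI[of 1 0] unfolding Idl by simp
  next
    case 2
    hence "1 \<in> J" by simp
    thus ?thesis unfolding J_def by auto
  qed
qed

lemma uniformizer_dvd_mult:
  fixes u :: "'a::comm_ring_1"
  assumes "uniformizer (ring_of_type_algebra :: 'a ring) u" "u dvd a * b"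
  shows "u dvd a \<or> u dvd b"
proof (rule disjCI)
  assume "\<not> u dvd b"
  then obtain x y where "x * b + y * u = 1" using uniformizer_dvd_or_comaximal(2)[OF assms(1)] by blast
  hence "a = x * (a * b) + a * y * u" by (metis distrib_left mult.assoc mult.left_commute mult.right_neutral)
  also have "u dvd \<dots>" using assms(2) by (intro dvd_add) auto
  finally show "u dvd a" .
qed

lemma uniformizer_dvd_power:
  fixes u :: "'a::comm_ring_1"
  assumes "uniformizer (ring_of_type_algebra :: 'a ring) u" "u dvd a ^ n"
  shows "u dvd a"
  using assms(2)
proof (induction n)
  case 0
  thus ?case using uniformizer_dvd_or_comaximal(1)[OF assms(1)] by simp
qed (use uniformizer_dvd_mult[OF assms(1)] in auto)

text \<open>A nonunit has an irreducible divisor, which in a principal ideal domain generates a maximal ideal;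
  there is only one.\<close>

lemma uniformizer_dvd_nonunit:
  fixes p :: "'a::idom"
  assumes D: "discrete_valuation_ring (ring_of_type_algebra :: 'a ring)"
    and u: "uniformizer (ring_of_type_algebra :: 'a ring) p"
    and b: "b \<noteq> 0" "\<not> b dvd 1"
  shows "p dvd b"
proof -
  let ?A = "ring_of_type_algebra :: 'a ring"
  interpret A: principal_domain ?A using D by (simp add: discrete_valuation_ring_def)
  have "b \<notin> Units ?A" using b(2) by (auto simp: Units_def dvd_def)
  moreover have "b \<in> carrier ?A - {\<zero>\<^bsub>?A\<^esub>}" using b(1) by simp
  ultimately obtain q where q: "q \<in> carrier ?A" "ring_irreducible\<^bsub>?A\<^esub> q" "q divides\<^bsub>?A\<^esub> b"
    using A.exists_irreducible_divisor[of b] by metis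
  have "maximalideal (PIdl\<^bsub>?A\<^esub> q) ?A" using A.irreducible_imp_maximalideal q by blast
  moreover have "maximalideal (Idl\<^bsub>?A\<^esub> {p}) ?A" using u by (simp add: uniformizer_def)
  moreover have "\<exists>!M. maximalideal M ?A" using D by (simp add: discrete_valuation_ring_def)
  ultimately have "PIdl\<^bsub>?A\<^esub> q = Idl\<^bsub>?A\<^esub> {p}" by blast
  also have "\<dots> = PIdl\<^bsub>?A\<^esub> p" by (rule A.cgenideal_eq_genideal[symmetric]) simp
  finally have "PIdl\<^bsub>?A\<^esub> q = PIdl\<^bsub>?A\<^esub> p" .
  hence "p dvd q" using A.cgenideal_self[of q] by (auto simp: cgenideal_def dvd_def mult.commute)
  also have "q dvd b" using q(3) by (auto simp: factor_def dvd_def)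
  finally show ?thesis .
qed

text \<open>Write \<open>n = p\<^sup>k m\<close> with \<open>m\<close> prime to \<open>p\<close>. If \<open>n\<close> vanished, so would \<open>m\<close>, and a Bezout relation
  between \<open>m\<close> and \<open>p\<close> would make \<open>p\<close> a unit.\<close>

lemma of_nat_nonzero_of_uniformizer:
  assumes p: "Factorial_Ring.prime p" and p_nz: "of_nat p \<noteq> (0::'a::idom)"
    and u: "uniformizer (ring_of_type_algebra :: 'a ring) (of_nat p)"
    and n: "n > 0"
  shows "of_nat n \<noteq> (0::'a)"
proof
  assume "of_nat n = (0::'a)"
  moreover have "\<not> is_unit p" using p by (meson not_prime_unit)
  ultimately obtain k m where m: "n = p ^ k * m" "\<not> p dvd m"
    using n multiplicity_decompose'[of n p] by (metis less_not_refl)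
  with \<open>of_nat n = 0\<close> have m0: "of_nat m = (0::'a)" using p_nz by simp
  have "coprime (int m) (int p)"
    using p m(2) by (metis prime_imp_coprime coprime_commute coprime_int_iff)
  then obtain a b where "a * int m + b * int p = 1" using bezout_int[of "int m" "int p"] by auto
  hence "(of_int (a * int m + b * int p) :: 'a) = 1" by simp
  hence "of_int b * of_nat p = (1::'a)" using m0 by simp
  hence "of_nat p dvd (1::'a)" by (metis dvd_triv_right)
  thus False using uniformizer_dvd_or_comaximal(1)[OF u] by simp
qed

section \<open>Constant terms of homogeneous ideals\<close>

lemma exponent_add_eq_zero_iff: "\<alpha> + \<beta> = 0 \<longleftrightarrow> \<alpha> = 0 \<and> \<beta> = (0 :: nat \<Rightarrow>\<^sub>0 nat)"
proof
  assume "\<alpha> + \<beta> = 0"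
  hence "Poly_Mapping.lookup \<alpha> i + Poly_Mapping.lookup \<beta> i = 0" for i
    using lookup_add[of \<alpha> \<beta> i] by simp
  thus "\<alpha> = 0 \<and> \<beta> = 0" by (auto intro!: poly_mapping_eqI)
qed simp

lemma lookup_mult_0:
  "Poly_Mapping.lookup (f * g) 0 = Poly_Mapping.lookup f 0 * Poly_Mapping.lookup (g :: 'a::comm_ring_1 mpoly) 0"
proof (induction f rule: poly_mapping_singles_induct)
  case (single \<alpha> a)
  show ?case
    by (induction g rule: poly_mapping_singles_induct)
       (auto simp: mult_single lookup_single when_def exponent_add_eq_zero_iff lookup_add distrib_left)
qed (simp_all add: lookup_add distrib_right)

lemma weighted_degree_eq_0:
  assumes "weighted_degree w \<alpha> = 0" "Poly_Mapping.keys \<alpha> \<subseteq> {1..m}" "\<And>i. i \<in> {1..m} \<Longrightarrow> w i > 0"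
  shows "\<alpha> = 0"
proof -
  have "i \<notin> Poly_Mapping.keys \<alpha>" for i
  proof
    assume i: "i \<in> Poly_Mapping.keys \<alpha>"
    hence "Poly_Mapping.lookup \<alpha> i * w i = 0" using assms(1) by (simp add: weighted_degree_def)
    moreover have "w i > 0" using i assms(2,3) by blast
    ultimately show False using i by (simp add: in_keys_iff)
  qed
  hence "Poly_Mapping.keys \<alpha> = {}" by blast
  thus ?thesis by simp
qed

lemma homogeneous_lookup_0:
  "f \<in> homogeneous_of_degree w d \<Longrightarrow> d > 0 \<Longrightarrow> Poly_Mapping.lookup f 0 = 0"
  by (rule ccontr) (force simp: homogeneous_of_degree_def simp flip: in_keys_iff)

lemma homogeneous_of_degree_0:
  fixes f :: "'a::comm_ring_1 mpoly"
  assumes "f \<in> homogeneous_of_degree w 0" "f \<in> polynomials m" "\<And>i. i \<in> {1..m} \<Longrightarrow> w i > 0"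
  shows "f = mconst (Poly_Mapping.lookup f 0)"
proof -
  have "\<alpha> = 0" if "\<alpha> \<in> Poly_Mapping.keys f" for \<alpha>
    using that assms weighted_degree_eq_0[of w \<alpha> m] by (auto simp: homogeneous_of_degree_def polynomials_def)
  thus ?thesis by (intro poly_mapping_eqI) (auto simp: lookup_single when_def in_keys_iff)
qed

text \<open>As all weights are positive, a homogeneous generator either has constant term zero or is itself a
  constant. The elements of \<open>R\<close> whose constant term lies in \<open>Q\<close> form an ideal.\<close>

lemma constant_coeff_in_homogeneous_ideal:
  fixes R :: "'a::idom mpoly set"
  assumes R: "subring_set R" and RS: "R \<subseteq> polynomials m" and C: "range mconst \<subseteq> R"
    and w: "\<And>i. i \<in> {1..m} \<Longrightarrow> w i > 0"
    and Q: "ideal Q (ring_on R)" and hQ: "homogeneous_ideal (homogeneous_of_degree w) R Q"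
    and y: "y \<in> Q"
  shows "mconst (Poly_Mapping.lookup y 0) \<in> Q"
proof -
  note Q' = ring_on_idealD[OF Q] and R' = subring_setD[OF R]
  obtain H where H: "H \<subseteq> (\<Union>d. R \<inter> homogeneous_of_degree w d)" "Q = Idl\<^bsub>ring_on R\<^esub> H"
    using hQ by (auto simp: homogeneous_ideal_def)
  define K where "K = {x \<in> R. mconst (Poly_Mapping.lookup x 0) \<in> Q}"
  have "ideal K (ring_on R)"
  proof (rule ring_on_idealI[OF R])
    fix x u assume "x \<in> K" "u \<in> R"
    moreover have "mconst (Poly_Mapping.lookup u 0) \<in> R" using C by blast
    ultimately show "u * x \<in> K"
      by (auto simp: K_def lookup_mult_0 mconst_mult intro: R' Q')
  qed (auto simp: K_def lookup_add mconst_add intro: R' Q')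
  moreover have "H \<subseteq> K"
  proof
    fix h assume h: "h \<in> H"
    then obtain d where d: "h \<in> R" "h \<in> homogeneous_of_degree w d" using H(1) by auto
    have "H \<subseteq> R" using H(1) by auto
    hence hQ: "h \<in> Q" using Idl_ring_on_ideal(2)[OF R] h H(2) by blast
    have "mconst (Poly_Mapping.lookup h 0) \<in> Q"
    proof (cases "d = 0")
      case True
      thus ?thesis using homogeneous_of_degree_0[of h w m] d RS w hQ by auto
    next
      case False
      thus ?thesis using homogeneous_lookup_0[OF d(2)] Q'(2) by simp
    qed
    thus "h \<in> K" using d by (simp add: K_def)
  qed
  ultimately have "Q \<subseteq> K" unfolding H(2) by (rule Idl_ring_on_subset)
  thus ?thesis using y by (auto simp: K_def)
qed

section \<open>Graded splittings\<close>

locale graded_retract =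
  fixes w :: "nat \<Rightarrow> nat" and m :: nat and R :: "'a::idom mpoly set" and \<beta> :: "'a mpoly \<Rightarrow> 'a mpoly"
  assumes w: "\<And>i. i \<in> {1..m} \<Longrightarrow> w i > 0"
    and R: "subring_set R" and R_sub: "R \<subseteq> polynomials m" and const_R: "mconst c \<in> R"
    and \<beta>_R: "s \<in> polynomials m \<Longrightarrow> \<beta> s \<in> R"
    and \<beta>_add: "s \<in> polynomials m \<Longrightarrow> s' \<in> polynomials m \<Longrightarrow> \<beta> (s + s') = \<beta> s + \<beta> s'"
    and \<beta>_mult: "r \<in> R \<Longrightarrow> s \<in> polynomials m \<Longrightarrow> \<beta> (r * s) = r * \<beta> s"
    and \<beta>_deg: "s \<in> polynomials m \<Longrightarrow> s \<in> homogeneous_of_degree w d \<Longrightarrow> \<beta> s \<in> homogeneous_of_degree w d"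
    and \<beta>_id: "r \<in> R \<Longrightarrow> \<beta> r = r"
begin

lemmas R_ring = subring_setD[OF R]

lemma \<beta>_zero: "\<beta> 0 = 0"
  using \<beta>_id R_ring(2) by simp

text \<open>The splitting fixes \<open>A\<close>, and it maps each nonconstant monomial to an element of positive degree.\<close>

lemma lookup_\<beta>_0:
  assumes "s \<in> polynomials m"
  shows "Poly_Mapping.lookup (\<beta> s) 0 = Poly_Mapping.lookup s 0"
proof -
  have "s \<in> polynomials m \<and> Poly_Mapping.lookup (\<beta> s) 0 = Poly_Mapping.lookup s 0"
  proof (induction s rule: poly_mapping_singles_induct)
    case (single \<alpha> c)
    hence k: "Poly_Mapping.keys \<alpha> \<subseteq> {1..m}" using assms by (auto simp: polynomials_def)
    hence S: "Poly_Mapping.single \<alpha> c \<in> polynomials m" by (rule single_in_polynomials)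
    show ?case
    proof (cases "\<alpha> = 0")
      case True
      thus ?thesis using \<beta>_id[OF const_R[of c]] S by simp
    next
      case False
      hence "weighted_degree w \<alpha> > 0" using weighted_degree_eq_0[of w \<alpha> m] k w by blast
      moreover have "\<beta> (Poly_Mapping.single \<alpha> c) \<in> homogeneous_of_degree w (weighted_degree w \<alpha>)"
        by (rule \<beta>_deg[OF S]) (simp add: homogeneous_of_degree_def)
      ultimately have "Poly_Mapping.lookup (\<beta> (Poly_Mapping.single \<alpha> c)) 0 = 0"
        by (rule homogeneous_lookup_0[rotated])
      thus ?thesis using S False by (simp add: lookup_single)
    qed
  next
    case (add f g)
    thus ?case by (simp add: \<beta>_add polynomials_add lookup_add)
  qed (simp add: \<beta>_zero)
  thus ?thesis by simp
qed

text \<open>The composite \<open>\<sigma>\<close> of the splitting with a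
  slice is \<open>R\<close>-linear and maps \<open>Q T\<close> into \<open>Q\<close>. From \<open>s y \<in> Q T\<close> follows \<open>s \<sigma>(y) \<in> Q\<close>, hence
  \<open>\<sigma>(y) \<in> Q\<close>, and the constant term of \<open>\<sigma>(y)\<close> is the coefficient of \<open>y\<close> in question.\<close>

lemma coeff_in_prime_of_saturated:
  assumes Q: "primeideal Q (ring_on R)" and hQ: "homogeneous_ideal (homogeneous_of_degree w) R Q"
    and y: "y \<in> saturated_power (R - Q) Q 1" and \<gamma>: "Poly_Mapping.keys \<gamma> \<inter> {1..m} = {}"
  shows "mconst (Poly_Mapping.lookup y \<gamma>) \<in> Q"
proof -
  interpret Q: primeideal Q "ring_on R" by fact
  note Q' = ring_on_idealD[OF Q.is_ideal]
  let ?\<sigma> = "\<lambda>z. \<beta> (slice m \<gamma> z)"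
  have \<sigma>_mult: "?\<sigma> (r * z) = r * ?\<sigma> z" if "r \<in> R" for r z
    using that R_sub by (subst slice_mult) (auto simp: \<beta>_mult slice_in_polynomials)
  have \<sigma>_Q: "k = Suc 0 \<Longrightarrow> ?\<sigma> z \<in> Q" if "extended_power Q k z" for k z
    using that
  proof (induction rule: extended_power.induct)
    case (mult q k a)
    moreover have "q \<in> R" using mult Q'(1) by blast
    ultimately show ?case by (auto simp: \<sigma>_mult intro!: Q'(5) \<beta>_R slice_in_polynomials)
  qed (auto simp: slice_add \<beta>_add slice_in_polynomials \<beta>_zero intro: Q')
  obtain s where s: "s \<in> R - Q" "extended_power Q 1 (s * y)" using y by (rule saturated_powerE)
  have "s * ?\<sigma> y \<in> Q" using \<sigma>_Q[OF s(2)] s(1) \<sigma>_mult[of s y] by simp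
  moreover have "?\<sigma> y \<in> R" by (intro \<beta>_R slice_in_polynomials)
  ultimately have "?\<sigma> y \<in> Q" using Q.I_prime[of s "?\<sigma> y"] s(1) by auto
  hence "mconst (Poly_Mapping.lookup (?\<sigma> y) 0) \<in> Q"
    using constant_coeff_in_homogeneous_ideal[OF R R_sub _ w Q.is_ideal hQ] const_R by blast
  thus ?thesis by (simp add: lookup_\<beta>_0 slice_in_polynomials lookup_slice_0[OF \<gamma>])
qed

end

section \<open>Coefficients of elements of saturated powers\<close>

text \<open>The lift of Frobenius on \<open>T\<close> is chosen such that the blowup map \<open>\<psi>\<close> intertwines it with the
  lift \<open>z\<^sub>i \<mapsto> z\<^sub>i\<^sup>p\<close> on the target; then \<open>\<psi>\<close> intertwines the two \<open>p\<close>-derivations. An element of the \<open>k+1\<close>-st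
  saturated power is mapped by \<open>\<Delta>\<close> into the \<open>k\<close>-th one, so by induction \<open>p\<^sup>k\<close> divides
  \<open>\<psi>(\<Delta> y) = \<Delta>'(\<psi> y)\<close>, and \<open>\<Delta>'\<close> lowers the order in \<open>p\<close> by at most one.

  The variables \<open>z\<^sub>i\<close> act as the coordinates of a generic direction. With constants in their place the
  argument would need a point, over the residue field, at which a given form does not vanish, and the
  residue field may be finite.\<close>

lemma power_dvd_blowup_of_saturated:
  fixes y :: "'a::idom mpoly" and \<phi> \<delta> :: "'a \<Rightarrow> 'a"
  assumes A: "frobenius_lift p \<phi> \<delta>" and reflect: "\<And>c. of_nat p dvd \<phi> c \<Longrightarrow> of_nat p dvd c"
    and pQ: "of_nat p \<in> Q" and W1: "1 \<in> W" and Wm: "\<And>s t. s \<in> W \<Longrightarrow> t \<in> W \<Longrightarrow> s * t \<in> W"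
    and base: "\<And>y \<gamma>. y \<in> saturated_power W Q 1 \<Longrightarrow> Poly_Mapping.keys \<gamma> \<inter> {1..m} = {}
                 \<Longrightarrow> of_nat p dvd Poly_Mapping.lookup y \<gamma>"
    and y: "y \<in> saturated_power W Q k"
  shows "of_nat p ^ k dvd blowup p m y"
proof -
  interpret A: frobenius_lift p \<phi> \<delta> by fact
  have p0: "p > 0" using A.p prime_gt_0_nat by blast
  \<comment> \<open>the lift has to satisfy \<open>\<psi>(\<phi>(x\<^sub>i)) = \<phi>'(p z\<^sub>i) = p z\<^sub>i\<^sup>p\<close>, while \<open>\<psi>(x\<^sub>i\<^sup>p) = p\<^sup>p z\<^sub>i\<^sup>p\<close>; so
    \<open>\<phi>(x\<^sub>i) = x\<^sub>i\<^sup>p + (p - p\<^sup>p) z\<^sub>i\<^sup>p\<close>\<close>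
  define g :: "nat \<Rightarrow> 'a mpoly"
    where "g i = (if i \<in> {1..m} then (1 - of_nat p ^ (p - 1)) * Var (i + m) ^ p else 0)" for i
  define \<Phi> where "\<Phi> = mpoly_eval (\<lambda>c. mconst (\<phi> c) :: 'a mpoly) (\<lambda>i. Var i ^ p + of_nat p * g i)"
  define \<Phi>' where "\<Phi>' = mpoly_eval (\<lambda>c. mconst (\<phi> c) :: 'a mpoly) (\<lambda>i. Var i ^ p)"
  obtain \<Delta> where \<Delta>: "frobenius_lift p \<Phi> \<Delta>"
    using frobenius_lift_mpoly[OF A, of g] unfolding \<Phi>_def by blast
  obtain \<Delta>' where \<Delta>': "frobenius_lift p \<Phi>' \<Delta>'"
    using frobenius_lift_mpoly[OF A, of "\<lambda>_. 0"] unfolding \<Phi>'_def by auto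
  interpret D: frobenius_lift p \<Phi> \<Delta> by fact
  interpret D': frobenius_lift p \<Phi>' \<Delta>' by fact
  let ?\<psi> = "blowup p m :: 'a mpoly \<Rightarrow> 'a mpoly"
  note \<psi> = is_ring_homD[OF blowup_ring_hom, of p m]
  have h: "is_ring_hom (\<lambda>c. mconst (\<phi> c) :: 'a mpoly)"
    by (rule is_ring_hom_comp[OF is_ring_hom_mconst A.hom])
  have \<psi>_Var: "?\<psi> (Var i) = (if i \<in> {1..m} then of_nat p * Var i else Var (i - m))" for i
    unfolding blowup_def by (rule mpoly_eval_Var[OF is_ring_hom_mconst])
  have \<psi>_const: "?\<psi> (mconst c) = mconst c" for c
    unfolding blowup_def by (rule mpoly_eval_mconst[OF is_ring_hom_mconst])
  have comm: "?\<psi> (\<Phi> x) = \<Phi>' (?\<psi> x)" for x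
  proof (rule ring_hom_mpoly_eqI[of "\<lambda>x. ?\<psi> (\<Phi> x)" "\<lambda>x. \<Phi>' (?\<psi> x)"])
    fix c
    show "?\<psi> (\<Phi> (mconst c)) = \<Phi>' (?\<psi> (mconst c))"
      unfolding \<psi>_const \<Phi>_def \<Phi>'_def mpoly_eval_mconst[OF h] ..
  next
    fix i
    have \<Phi>_Var: "\<Phi> (Var i) = Var i ^ p + of_nat p * g i"
      unfolding \<Phi>_def by (rule mpoly_eval_Var[OF h])
    have \<Phi>'_Var: "\<Phi>' (Var j) = Var j ^ p" for j
      unfolding \<Phi>'_def by (rule mpoly_eval_Var[OF h])
    show "?\<psi> (\<Phi> (Var i)) = \<Phi>' (?\<psi> (Var i))"
    proof (cases "i \<in> {1..m}")
      case True
      have pp: "(of_nat p :: 'a mpoly) ^ p = of_nat p * of_nat p ^ (p - 1)" by (rule D.power_p)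
      have "i + m \<notin> {1..m}" using True by auto
      hence "?\<psi> (\<Phi> (Var i)) = (of_nat p * Var i) ^ p + of_nat p * ((1 - of_nat p ^ (p - 1)) * Var i ^ p)"
        using True by (simp only: \<Phi>_Var g_def \<psi> \<psi>_Var if_True if_False add_diff_cancel_right')
      also have "\<dots> = of_nat p * Var i ^ p"
        by (simp only: power_mult_distrib pp) (simp add: algebra_simps)
      also have "\<dots> = \<Phi>' (?\<psi> (Var i))"
        using True by (simp only: \<psi>_Var if_True D'.\<phi> \<Phi>'_Var)
      finally show ?thesis .
    next
      case False
      thus ?thesis by (simp only: \<Phi>_Var g_def \<psi> \<psi>_Var \<Phi>'_Var if_False mult_zero_right add_0_right)
    qed
  next
    show "is_ring_hom (\<lambda>x. ?\<psi> (\<Phi> x))" by (rule is_ring_hom_comp[OF blowup_ring_hom D.hom])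
    show "is_ring_hom (\<lambda>x. \<Phi>' (?\<psi> x))" by (rule is_ring_hom_comp[OF D'.hom blowup_ring_hom])
  qed
  have \<psi>_\<Delta>: "?\<psi> (\<Delta> x) = \<Delta>' (?\<psi> x)" for x
  proof -
    have "?\<psi> x ^ p + of_nat p * ?\<psi> (\<Delta> x) = ?\<psi> x ^ p + of_nat p * \<Delta>' (?\<psi> x)"
      using comm[of x] unfolding D.lift D'.lift by (simp only: \<psi>)
    thus ?thesis using D.p_cancel by (simp only: add_left_cancel)
  qed
  have reflect': "of_nat p dvd u" if "of_nat p dvd \<Phi>' u" for u
    by (rule frobenius_mpoly_reflects_dvd[OF A.hom p0]) (use reflect that in \<open>auto simp: \<Phi>'_def\<close>)
  show ?thesis using y
  proof (induction k arbitrary: y)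
    case (Suc k)
    have "y \<in> saturated_power W Q 1" using Suc.prems
      by (induction k) (auto dest: set_mp[OF saturated_power_Suc_subset])
    hence "of_nat p dvd ?\<psi> y" by (intro of_nat_dvd_blowup base)
    moreover have "\<Delta> y \<in> saturated_power W Q k"
      by (rule D.delta_saturated_power[OF pQ W1 Wm Suc.prems])
    hence "of_nat p ^ k dvd \<Delta>' (?\<psi> y)" unfolding \<psi>_\<Delta>[symmetric] by (rule Suc.IH)
    ultimately show ?case
      using D'.power_dvd_of_delta[of "?\<psi> y" k] reflect' by blast
  qed simp
qed

text \<open>In characteristic zero every coefficient is, up to a nonzero integer factor, the constant term of an
  iterated partial derivative; \<open>|\<alpha>| < k\<close> derivatives of an element of the \<open>k\<close>-th saturated power
  lie at least in the first one.\<close>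

lemma lookup_eq_0_of_saturated:
  fixes y :: "'a::idom mpoly"
  assumes char0: "\<And>n. n > 0 \<Longrightarrow> of_nat n \<noteq> (0::'a)"
    and W1: "1 \<in> W" and Wm: "\<And>s t. s \<in> W \<Longrightarrow> t \<in> W \<Longrightarrow> s * t \<in> W"
    and base: "\<And>y. y \<in> saturated_power W Q 1 \<Longrightarrow> Poly_Mapping.lookup y 0 = 0"
    and y: "y \<in> saturated_power W Q k" and k: "total_degree \<alpha> < k"
  shows "Poly_Mapping.lookup y \<alpha> = 0"
  using y k
proof (induction k arbitrary: y \<alpha>)
  case (Suc k)
  show ?case
  proof (cases "\<alpha> = 0")
    case True
    have "y \<in> saturated_power W Q 1" using Suc.prems(1)
      by (induction k) (auto dest: set_mp[OF saturated_power_Suc_subset])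
    thus ?thesis using True base by simp
  next
    case False
    then obtain i where i: "Poly_Mapping.lookup \<alpha> i \<noteq> 0"
      using poly_mapping_eqI[of \<alpha> 0] by auto
    define \<beta> where "\<beta> = \<alpha> - Poly_Mapping.single i 1"
    have \<alpha>: "\<alpha> = \<beta> + Poly_Mapping.single i 1"
      unfolding \<beta>_def using i
      by (intro poly_mapping_eqI) (auto simp: lookup_add lookup_minus lookup_single when_def)
    have "partial_deriv i y \<in> saturated_power W Q k"
      by (rule derivation_saturated_power[OF partial_deriv_add partial_deriv_mult Wm Suc.prems(1)])
    moreover have "total_degree \<beta> < k"
      using Suc.prems(2) by (simp add: \<alpha> weighted_degree_add weighted_degree_single)
    ultimately have "Poly_Mapping.lookup (partial_deriv i y) \<beta> = 0" by (rule Suc.IH)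
    hence "of_nat (Suc (Poly_Mapping.lookup \<beta> i)) * Poly_Mapping.lookup y \<alpha> = 0"
      by (simp only: lookup_partial_deriv \<alpha>)
    thus ?thesis using char0[of "Suc (Poly_Mapping.lookup \<beta> i)"] by (simp only: mult_eq_0_iff) simp
  qed
qed simp

section \<open>Degrees and powers of the maximal ideal\<close>

definition homogeneous_component :: "(nat \<Rightarrow> nat) \<Rightarrow> nat \<Rightarrow> 'a::comm_ring_1 mpoly \<Rightarrow> 'a mpoly"
  where "homogeneous_component w d = lin_ext (\<lambda>\<alpha> c. if weighted_degree w \<alpha> = d then Poly_Mapping.single \<alpha> c else 0)"

lemma homogeneous_component_add:
  "homogeneous_component w d (f + g) = homogeneous_component w d f + homogeneous_component w d g"
  unfolding homogeneous_component_def by (rule lin_ext_add) (simp_all add: single_add)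

lemma homogeneous_component_zero [simp]: "homogeneous_component w d 0 = 0"
  by (simp add: homogeneous_component_def)

lemma lookup_homogeneous_component:
  "Poly_Mapping.lookup (homogeneous_component w d f) \<alpha> =
    (if weighted_degree w \<alpha> = d then Poly_Mapping.lookup f \<alpha> else 0)"
proof (induction f rule: poly_mapping_singles_induct)
  case (single \<beta> c)
  show ?case by (auto simp: homogeneous_component_def lin_ext_single lookup_single when_def)
qed (simp_all add: homogeneous_component_add lookup_add)

lemma homogeneous_component_homogeneous: "homogeneous_component w d f \<in> homogeneous_of_degree w d"
  by (auto simp: homogeneous_of_degree_def in_keys_iff lookup_homogeneous_component split: if_splits)

lemma homogeneous_component_of_homogeneous:
  assumes "f \<in> homogeneous_of_degree w e"
  shows "homogeneous_component w d f = (if d = e then f else 0)"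
proof (rule poly_mapping_eqI)
  fix \<alpha>
  have "weighted_degree w \<alpha> = e" if "Poly_Mapping.lookup f \<alpha> \<noteq> 0"
    using assms that by (auto simp: homogeneous_of_degree_def in_keys_iff)
  thus "Poly_Mapping.lookup (homogeneous_component w d f) \<alpha> = Poly_Mapping.lookup (if d = e then f else 0) \<alpha>"
    by (auto simp: lookup_homogeneous_component)
qed

lemma sum_homogeneous_components:
  "f = (\<Sum>d\<in>weighted_degree w ` Poly_Mapping.keys f. homogeneous_component w d f)"
  by (rule poly_mapping_eqI)
     (auto simp: lookup_sum lookup_homogeneous_component in_keys_iff intro!: sum.neutral)

lemma homogeneous_mult:
  assumes "f \<in> homogeneous_of_degree w d" "g \<in> homogeneous_of_degree w e"
  shows "f * g \<in> homogeneous_of_degree w (d + e)"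
proof -
  have "weighted_degree w \<alpha> = d + e" if "\<alpha> \<in> Poly_Mapping.keys (f * g)" for \<alpha>
    using keys_mult[of f g] that assms by (fastforce simp: homogeneous_of_degree_def weighted_degree_add)
  thus ?thesis by (simp add: homogeneous_of_degree_def)
qed

lemma mconst_homogeneous: "mconst c \<in> homogeneous_of_degree w 0"
  by (simp add: homogeneous_of_degree_def)

text \<open>The sums of homogeneous elements of degree \<open>d\<close> that lie in \<open>I\<^sup>j\<close> for some \<open>j \<ge> d/D\<close>. The product of
  two such elements is again such an element, so this is a subring.\<close>

inductive_set degree_filtered :: "(nat \<Rightarrow> nat) \<Rightarrow> 'a::comm_ring_1 mpoly set \<Rightarrow> 'a mpoly set \<Rightarrow> nat \<Rightarrow> 'a mpoly set"
  for w R I D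
  where
    zero: "0 \<in> degree_filtered w R I D"
  | homogeneous: "x \<in> homogeneous_of_degree w d \<Longrightarrow> x \<in> ideal_power (ring_on R) I j \<Longrightarrow> d \<le> j * D
       \<Longrightarrow> x \<in> degree_filtered w R I D"
  | add: "x \<in> degree_filtered w R I D \<Longrightarrow> y \<in> degree_filtered w R I D \<Longrightarrow> x + y \<in> degree_filtered w R I D"

lemma degree_filtered_mult:
  assumes R: "subring_set R" and I: "ideal I (ring_on R)"
    and x: "x \<in> degree_filtered w R I D" and y: "y \<in> degree_filtered w R I D"
  shows "x * y \<in> degree_filtered w R I D"
  using x
proof (induction x rule: degree_filtered.induct)
  case (homogeneous x d j)
  show ?case using y
  proof (induction y rule: degree_filtered.induct)
    case (homogeneous y e k)
    show ?case
    proof (rule degree_filtered.homogeneous)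
      show "x * y \<in> homogeneous_of_degree w (d + e)"
        by (rule homogeneous_mult) fact+
      show "x * y \<in> ideal_power (ring_on R) I (j + k)"
        by (rule ideal_power_mult[OF R I]) fact+
      show "d + e \<le> (j + k) * D"
        using \<open>d \<le> j * D\<close> \<open>e \<le> k * D\<close> by (simp add: distrib_right)
    qed
  qed (auto simp: distrib_left intro: degree_filtered.intros)
qed (auto simp: distrib_right intro: degree_filtered.intros)

lemma homogeneous_component_degree_filtered:
  assumes R: "subring_set R" and I: "ideal I (ring_on R)" and D: "D > 0"
    and x: "x \<in> degree_filtered w R I D"
  shows "\<exists>j. d \<le> j * D \<and> homogeneous_component w d x \<in> ideal_power (ring_on R) I j"
  using x
proof (induction x rule: degree_filtered.induct)
  case zero
  show ?case using D ring_on_idealD(2)[OF ideal_power_ideal[OF R I]] by (intro exI[of _ d]) simp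
next
  case (homogeneous x e j)
  show ?case
  proof (cases "d = e")
    case True
    thus ?thesis using homogeneous by (auto simp: homogeneous_component_of_homogeneous)
  next
    case False
    thus ?thesis using homogeneous D ring_on_idealD(2)[OF ideal_power_ideal[OF R I]]
      by (intro exI[of _ d]) (simp add: homogeneous_component_of_homogeneous)
  qed
next
  case (add x y)
  then obtain j k where jk: "d \<le> j * D" "homogeneous_component w d x \<in> ideal_power (ring_on R) I j"
    "d \<le> k * D" "homogeneous_component w d y \<in> ideal_power (ring_on R) I k" by blast
  have "homogeneous_component w d x \<in> ideal_power (ring_on R) I (min j k)"
    "homogeneous_component w d y \<in> ideal_power (ring_on R) I (min j k)"
    using jk ideal_power_antimono[OF R I, of "min j k" j] ideal_power_antimono[OF R I, of "min j k" k] by auto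
  moreover have "d \<le> min j k * D" using jk by (simp add: min_def)
  ultimately show ?case
    using ring_on_idealD(3)[OF ideal_power_ideal[OF R I, of "min j k"]]
    by (intro exI[of _ "min j k"]) (simp add: homogeneous_component_add)
qed

lemma generated_subalgebra_degree_filtered:
  fixes F :: "'a::comm_ring_1 mpoly set"
  assumes R: "subring_set R" and I: "ideal I (ring_on R)" and gen: "R = subalgebra_generated F"
    and F: "F \<subseteq> I" and deg: "\<And>h. h \<in> F \<Longrightarrow> \<exists>d. d \<le> D \<and> h \<in> homogeneous_of_degree w d"
    and x: "x \<in> R"
  shows "x \<in> degree_filtered w R I D"
proof -
  have const_R: "mconst c \<in> R" for c
    unfolding gen subalgebra_generated_def by (auto intro: generate_ring.incl)
  have const: "mconst c \<in> degree_filtered w R I D" for c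
    by (rule degree_filtered.homogeneous[of _ _ 0 _ _ 0])
       (simp_all add: mconst_homogeneous const_R)
  have "x \<in> generate_ring ring_of_type_algebra (range mconst \<union> F)"
    using x unfolding gen subalgebra_generated_def .
  thus ?thesis
  proof (induction x rule: generate_ring.induct)
    case one
    show ?case using const[of 1] by simp
  next
    case (incl h)
    have "h \<in> degree_filtered w R I D" if h: "h \<in> F"
    proof -
      obtain d where "d \<le> D" "h \<in> homogeneous_of_degree w d" using deg[OF h] by blast
      moreover have "h \<in> ideal_power (ring_on R) I 1"
        using ideal_power_power[OF R I, of h 1] F h by auto
      ultimately show ?thesis by (intro degree_filtered.homogeneous[of h w d R I 1 D]) auto
    qed
    thus ?case using incl const by auto
  next
    case (a_inv h)
    have "mconst (-1) * h \<in> degree_filtered w R I D"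
      by (rule degree_filtered_mult[OF R I const a_inv.IH])
    thus ?case by (simp add: single_uminus)
  qed (auto intro: degree_filtered.add degree_filtered_mult[OF R I])
qed

text \<open>Since \<open>|\<alpha>|\<close> is at most the weighted degree of \<open>\<alpha>\<close>, the component of \<open>x\<close> of degree \<open>d\<close> is \<open>p\<^sup>e\<close> times
  an element \<open>y\<close> of \<open>S\<close>, where \<open>e = max (n D - d) 0\<close>. The splitting allows to replace \<open>y\<close> by an element
  of \<open>R\<close> of degree \<open>d\<close>, which lies in \<open>I\<^sup>j\<close> with \<open>j \<ge> d/D\<close>. Finally \<open>e + j \<ge> n\<close>.\<close>

lemma (in graded_retract) in_ideal_power_of_coeffs:
  assumes gen: "R = subalgebra_generated F" and D: "D > 0" and I: "ideal I (ring_on R)"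
    and F: "F \<subseteq> I" and pI: "of_nat p \<in> I" and p_nz: "of_nat p \<noteq> (0::'a)"
    and deg: "\<And>h. h \<in> F \<Longrightarrow> \<exists>d. d \<le> D \<and> h \<in> homogeneous_of_degree w d"
    and x: "x \<in> R" and coeff: "\<And>\<alpha>. of_nat p ^ (n * D - total_degree \<alpha>) dvd Poly_Mapping.lookup x \<alpha>"
  shows "x \<in> ideal_power (ring_on R) I n"
proof -
  note P = ring_on_idealD[OF ideal_power_ideal[OF R I, of n]]
  have filt: "z \<in> degree_filtered w R I D" if "z \<in> R" for z
    using generated_subalgebra_degree_filtered[OF R I gen F] deg that by blast
  have comp: "homogeneous_component w d x \<in> ideal_power (ring_on R) I n" for d
  proof -
    let ?x = "homogeneous_component w d x"
    have xS: "x \<in> polynomials m" using x R_sub by blast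
    have "?x \<in> R"
      using homogeneous_component_degree_filtered[OF R I D filt[OF x], of d]
        ring_on_idealD(1)[OF ideal_power_ideal[OF R I]] by blast
    define e where "e = n * D - d"
    have "of_nat (p ^ e) dvd Poly_Mapping.lookup ?x \<alpha>" for \<alpha>
    proof (cases "weighted_degree w \<alpha> = d \<and> \<alpha> \<in> Poly_Mapping.keys x")
      case True
      hence "Poly_Mapping.keys \<alpha> \<subseteq> {1..m}" using xS by (auto simp: polynomials_def)
      have "total_degree \<alpha> \<le> weighted_degree w \<alpha>"
        unfolding weighted_degree_def
        by (rule sum_mono) (use w \<open>Poly_Mapping.keys \<alpha> \<subseteq> {1..m}\<close> in \<open>auto simp: Suc_le_eq subset_iff\<close>)
      hence "e \<le> n * D - total_degree \<alpha>" using True by (simp add: e_def)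
      hence "of_nat p ^ e dvd Poly_Mapping.lookup x \<alpha>"
        using coeff[of \<alpha>] by (meson dvd_trans le_imp_power_dvd)
      thus ?thesis by (simp add: lookup_homogeneous_component)
    qed (auto simp: lookup_homogeneous_component in_keys_iff)
    hence "of_nat (p ^ e) dvd ?x" using of_nat_dvd_mpoly_iff by blast
    then obtain y where y: "?x = of_nat (p ^ e) * y" by (rule dvdE)
    have pe: "of_nat (p ^ e) \<noteq> (0::'a)" using p_nz by simp
    have keys: "Poly_Mapping.keys y \<subseteq> Poly_Mapping.keys ?x"
      unfolding y using pe by (auto simp: in_keys_iff lookup_of_nat_mult simp del: of_nat_power)
    have keys': "Poly_Mapping.keys ?x \<subseteq> Poly_Mapping.keys x"
      by (auto simp: in_keys_iff lookup_homogeneous_component split: if_splits)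
    have yS: "y \<in> polynomials m" using keys keys' xS by (auto simp: polynomials_def)
    have yd: "y \<in> homogeneous_of_degree w d"
      using keys homogeneous_component_homogeneous[of w d x] by (auto simp: homogeneous_of_degree_def)
    have peR: "of_nat (p ^ e) \<in> R" using const_R[of "of_nat (p ^ e)"] by (simp only: single_of_nat)
    have "?x = of_nat (p ^ e) * \<beta> y"
      using \<beta>_id[OF \<open>?x \<in> R\<close>] \<beta>_mult[OF peR yS] unfolding y by simp
    moreover have \<beta>y: "\<beta> y \<in> R" "\<beta> y \<in> homogeneous_of_degree w d"
      using \<beta>_R[OF yS] \<beta>_deg[OF yS yd] by auto
    obtain j where j: "d \<le> j * D" "\<beta> y \<in> ideal_power (ring_on R) I j"
      using homogeneous_component_degree_filtered[OF R I D filt[OF \<beta>y(1)], of d]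
      by (auto simp: homogeneous_component_of_homogeneous[OF \<beta>y(2)])
    moreover have "of_nat p ^ e \<in> ideal_power (ring_on R) I e" by (rule ideal_power_power[OF R I pI])
    ultimately have "?x \<in> ideal_power (ring_on R) I (e + j)"
      using ideal_power_mult[OF R I, of "of_nat p ^ e" e "\<beta> y" j] by simp
    moreover have "n \<le> e + j"
    proof (rule ccontr)
      \<comment> \<open>otherwise \<open>n D \<ge> (e + j + 1) D \<ge> e + d + D\<close>, against \<open>e \<ge> n D - d\<close>\<close>
      assume "\<not> n \<le> e + j"
      hence "(e + j + 1) * D \<le> n * D" by (intro mult_right_mono) auto
      moreover have "e \<le> e * D" using D by simp
      ultimately show False using j(1) D unfolding e_def by (simp add: algebra_simps)
    qed
    ultimately show ?thesis using ideal_power_antimono[OF R I] by blast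
  qed
  have "(\<Sum>d\<in>A. homogeneous_component w d x) \<in> ideal_power (ring_on R) I n" if "finite A" for A
    using that by (induction A rule: finite_induct) (auto intro: P comp)
  thus ?thesis by (subst sum_homogeneous_components[of x w]) auto
qed

theorem theorem1:
  fixes p m t D :: nat
    and w :: "nat \<Rightarrow> nat"
    and f :: "nat \<Rightarrow> 'a::idom mpoly"
    and S R \<mm> :: "'a mpoly set"
  assumes "Factorial_Ring.prime p"
    and "discrete_valuation_ring (ring_of_type_algebra :: 'a ring)"
    and "uniformizer (ring_of_type_algebra :: 'a ring) (of_nat p)"
    and "perfect_field
           ((ring_of_type_algebra :: 'a ring) Quot
             (Idl\<^bsub>ring_of_type_algebra :: 'a ring\<^esub> {of_nat p}))"
    and "\<exists>\<delta> :: 'a \<Rightarrow> 'a. p_derivation p \<delta>"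
    and "S = polynomials m"
    and "\<And>i. i \<in> {1..m} \<Longrightarrow> w i > 0"
    and "D > 0"
    and "\<And>i. i \<in> {1..t} \<Longrightarrow> f i \<in> S"
    and "\<And>i. i \<in> {1..t} \<Longrightarrow> \<exists>d. 0 < d \<and> d \<le> D \<and> f i \<in> homogeneous_of_degree w d"
    and "R = subalgebra_generated (f ` {1..t})"
    and "graded_direct_summand (homogeneous_of_degree w) R S"
    and "\<mm> = Idl\<^bsub>ring_on R\<^esub> (f ` {1..t} \<union> {of_nat p})"
  shows "\<forall>n\<ge>1. \<forall>Q. primeideal Q (ring_on R) \<and> homogeneous_ideal (homogeneous_of_degree w) R Q \<longrightarrow>
           symbolic_power R Q (n * D) \<subseteq> ideal_power (ring_on R) \<mm> n"
proof (intro allI impI subsetI, elim conjE)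
  fix n Q x
  assume Q: "primeideal Q (ring_on R)" and hQ: "homogeneous_ideal (homogeneous_of_degree w) R Q"
    and x: "x \<in> symbolic_power R Q (n * D)"
  obtain \<delta> :: "'a \<Rightarrow> 'a" where \<delta>: "p_derivation p \<delta>" using assms(5) by blast
  have p_nz: "of_nat p \<noteq> (0::'a)"
    using \<delta> unfolding p_derivation_def by (metis mult_zero_left zero_neq_one)
  define \<phi> where "\<phi> c = c ^ p + of_nat p * \<delta> c" for c
  have "is_ring_hom \<phi>"
    using \<delta> unfolding p_derivation_def ring_hom_def is_ring_hom_def \<phi>_def by auto
  hence A: "frobenius_lift p \<phi> \<delta>"
    by unfold_locales (use assms(1) p_nz in \<open>auto simp: \<phi>_def\<close>)
  have reflect: "of_nat p dvd c" if "of_nat p dvd \<phi> c" for c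
  proof -
    have "of_nat p dvd \<phi> c - of_nat p * \<delta> c" using that by (intro dvd_diff) auto
    hence "of_nat p dvd c ^ p" by (simp add: \<phi>_def)
    thus ?thesis by (rule uniformizer_dvd_power[OF assms(3)])
  qed
  have R_eq: "R = generate_ring ring_of_type_algebra (range mconst \<union> f ` {1..t})"
    using assms(11) by (simp add: subalgebra_generated_def)
  have R: "subring_set R"
    unfolding R_eq by (rule subring_set_generate_ring)
  have const_R: "mconst c \<in> R" for c
    unfolding R_eq by (auto intro: generate_ring.incl)
  have f_R: "f ` {1..t} \<subseteq> R"
    unfolding R_eq by (auto intro: generate_ring.incl)
  obtain \<beta> where \<beta>: "R \<subseteq> S" "\<beta> \<in> S \<rightarrow> R" "\<forall>s\<in>S. \<forall>s'\<in>S. \<beta> (s + s') = \<beta> s + \<beta> s'"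
    "\<forall>r\<in>R. \<forall>s\<in>S. \<beta> (r * s) = r * \<beta> s"
    "\<forall>d. \<beta> ` (S \<inter> homogeneous_of_degree w d) \<subseteq> R \<inter> homogeneous_of_degree w d" "\<forall>r\<in>R. \<beta> r = r"
    using assms(12) unfolding graded_direct_summand_def by (elim conjE exE) (rule that; assumption)
  interpret graded_retract w m R \<beta>
  proof
    show "\<beta> s \<in> homogeneous_of_degree w d" if "s \<in> polynomials m" "s \<in> homogeneous_of_degree w d" for s d
      using \<beta>(5) that assms(6) by blast
  qed (use \<beta> assms(6,7) R const_R in auto)
  have pR: "of_nat p \<in> R" using const_R[of "of_nat p"] by (simp only: single_of_nat)
  have \<mm>: "ideal \<mm> (ring_on R)" "f ` {1..t} \<union> {of_nat p} \<subseteq> \<mm>"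
    unfolding assms(13) using Idl_ring_on_ideal[OF R, of "f ` {1..t} \<union> {of_nat p}"] f_R pR by auto
  interpret Q: primeideal Q "ring_on R" by fact
  note Q' = ring_on_idealD[OF Q.is_ideal] and W = primeideal_complement[OF Q]
  have xR: "x \<in> R" using x by (simp add: symbolic_power_def)
  have xsat: "x \<in> saturated_power (R - Q) Q (n * D)"
    using x symbolic_power_subset_saturated_power[OF R Q] by blast
  \<comment> \<open>\<open>Q \<inter> A\<close> is a proper ideal of \<open>A\<close>, and \<open>pA\<close> is maximal\<close>
  have p_dvd_coeff: "of_nat p dvd c" if c: "mconst c \<in> Q" and pQ: "of_nat p \<in> Q" for c
  proof (rule ccontr)
    assume "\<not> of_nat p dvd c"
    then obtain a b where "a * c + b * of_nat p = 1"
      using uniformizer_dvd_or_comaximal(2)[OF assms(3), of c] by blast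
    hence "mconst a * mconst c + mconst b * of_nat p = 1"
      by (metis mconst_add mconst_mult single_of_nat single_one)
    moreover have "mconst a * mconst c + mconst b * of_nat p \<in> Q" by (intro Q'(3,4) c pQ const_R)
    ultimately show False using W(1) by auto
  qed
  \<comment> \<open>let \<open>b\<close> generate the prime \<open>Q \<inter> A\<close>; if \<open>b = p b'\<close>, then \<open>b'\<close> lies in it too, so \<open>b\<close> divides \<open>b'\<close>\<close>
  have coeff_zero: "c = 0" if c: "mconst c \<in> Q" and pQ: "of_nat p \<notin> Q" for c
  proof -
    let ?A = "ring_of_type_algebra :: 'a ring"
    interpret A: principal_domain ?A using assms(2) by (simp add: discrete_valuation_ring_def)
    define C where "C = {c :: 'a. mconst c \<in> Q}"
    have "ideal C (ring_on UNIV)"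
    proof (rule ring_on_idealI)
      show "subring_set (UNIV :: 'a set)" by (simp add: subring_set_def)
    qed (auto simp: C_def mconst_add mconst_mult intro: Q' const_R)
    moreover have "ring_on UNIV = ?A" by (simp add: ring_of_type_algebra_def)
    ultimately obtain b where "C = PIdl\<^bsub>?A\<^esub> b" using A.exists_gen[of C] by auto
    hence C: "C = {y * b | y. True}" by (auto simp: cgenideal_def)
    have "b = 1 * b" by simp
    hence bC: "b \<in> C" unfolding C by blast
    have "b = 0"
    proof (rule ccontr)
      assume b0: "b \<noteq> 0"
      have "\<not> b dvd 1"
      proof
        assume "b dvd 1"
        then obtain y where "1 = y * b" by (metis dvdE mult.commute)
        hence "1 \<in> C" unfolding C by blast
        thus False using W(1) by (simp add: C_def)
      qed
      then obtain b' where b': "b = of_nat p * b'"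
        using uniformizer_dvd_nonunit[OF assms(2,3) b0] by blast
      have "of_nat p * mconst b' \<in> Q" using bC unfolding C_def b' by (simp add: mconst_mult)
      hence "mconst b' \<in> Q" using Q.I_prime[of "of_nat p" "mconst b'"] pQ pR const_R by auto
      then obtain y where y: "b' = y * b" using C unfolding C_def by blast
      have "b = of_nat p * (y * b)" by (subst y[symmetric]) (rule b')
      also have "\<dots> = b * (of_nat p * y)" by (simp only: mult_ac)
      finally have "of_nat p * y = 1" using b0 by (metis mult_cancel_left mult.right_neutral)
      thus False using uniformizer_dvd_or_comaximal(1)[OF assms(3)] by (metis dvd_triv_left)
    qed
    moreover have "c \<in> C" using c by (simp add: C_def)
    ultimately show ?thesis unfolding C by auto
  qed
  have "of_nat p ^ (n * D - total_degree \<alpha>) dvd Poly_Mapping.lookup x \<alpha>" for \<alpha>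
  proof (cases "of_nat p \<in> Q")
    case True
    have "of_nat p ^ (n * D) dvd blowup p m x"
      by (rule power_dvd_blowup_of_saturated[OF A reflect True W(1) W(2) _ xsat])
         (use True coeff_in_prime_of_saturated[OF Q hQ] p_dvd_coeff in auto)
    hence "of_nat (p ^ (n * D)) dvd blowup p m x" by simp
    hence "of_nat (p ^ (n * D)) dvd Poly_Mapping.lookup (blowup p m x) \<alpha>"
      using of_nat_dvd_mpoly_iff by blast
    hence *: "of_nat p ^ (n * D) dvd of_nat p ^ total_degree \<alpha> * Poly_Mapping.lookup x \<alpha>"
      using lookup_blowup[of x m p \<alpha>] xR R_sub by auto
    show ?thesis
    proof (cases "total_degree \<alpha> \<le> n * D")
      case True
      hence "(of_nat p :: 'a) ^ (n * D) = of_nat p ^ total_degree \<alpha> * of_nat p ^ (n * D - total_degree \<alpha>)"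
        by (simp flip: power_add)
      thus ?thesis using * p_nz by simp
    qed simp
  next
    case False
    have "Poly_Mapping.lookup x \<alpha> = 0" if "total_degree \<alpha> < n * D"
      by (rule lookup_eq_0_of_saturated[OF _ W(1) W(2) _ xsat that])
         (use of_nat_nonzero_of_uniformizer[OF assms(1) p_nz assms(3)]
            coeff_in_prime_of_saturated[OF Q hQ, of _ 0] coeff_zero False in auto)
    thus ?thesis by (cases "total_degree \<alpha> < n * D") auto
  qed
  thus "x \<in> ideal_power (ring_on R) \<mm> n"
    using in_ideal_power_of_coeffs[OF assms(11,8) \<mm>(1) _ _ p_nz _ xR] \<mm>(2) assms(10) by fastforce
qed

end
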